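(* Let $(M,g,J,\omega)$ be a $2m$-dimensional (real dimension) Kähler manifold equipped with a non-degenerate Hamiltonian $2$-form $\psi$ with distinct eigenvalues. Then the $2^m$ maximal isotropic distributions associated to $\psi$ are integrable and define $2^m$ distinct complex structures.
   Context: All statements are local. $\nabla$ is the Levi-Civita connection, $X^*=g(X,\cdot)$, $J$ acts on $1$-forms by $J(X^* )=(JX)^*$, and $\omega(X,Y)=g(JX,Y)$. A Hamiltonian $2$-form on a Kähler manifold is a (real) $(1,1)$-form $\psi$ such that for all vector fields $X$ $$\nabla_X\psi=\tfrac12\left(d\sigma\wedge J(X^* )-J(d\sigma)\wedge X^*\right),$$ where $\sigma=\mathrm{tr}_\omega\psi$ is the trace of $\psi$ with respect to $\omega$ (the pointwise inner product $\langle\psi,\omega\rangle$ of $2$-forms). The eigenvalues of $\psi$ are the $2m$ eigenvalues of the endomorphism of $T_{\mathbb C}M$ obtained by raising one index with $g$; they come in pairs $\pm\lambda_\mu$, and non-degenerate means that this endomorphism is invertible. With distinct eigenvalues there is locally a null coframe $\{\theta^\mu,\theta_\mu\}_{\mu=1}^m$ of $T^*_{\mathbb C}M$ ($g=c\sum_\mu\theta^\mu\odot\theta_\mu$ for a normalisation constant $c$, with $\theta_\mu$ a complex conjugate of $\theta^\mu$), unique up to rescalings, permutations and interchanges $\theta^\mu\leftrightarrow\theta_\mu$, with $\psi=\sum_\mu\lambda_\mu\theta^\mu\wedge\theta_\mu$. The $2^m$ maximal isotropic distributions associated to $\psi$ are the rank-$m$ subbundles of $T_{\mathbb C}M$ annihilated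 by $m$ one-forms, one chosen from each pair $\{\theta^\mu,\theta_\mu\}$. A distribution $\mathcal D$ is integrable if $[\mathcal D,\mathcal D]\subset\mathcal D$; since $g$ is positive definite, a maximal isotropic distribution is the same as an orthogonal almost complex structure, and integrability makes it a complex structure. *)

theory Defs
  imports "HOL-Analysis.Analysis"
begin

text \<open>
  Everything is local, so the manifold is an open subset of a coordinate space \<open>real^'n\<close>. Tensor
  fields are given by their components in the coordinate frame: vectors and 1-forms are elements of
  \<open>real^'n\<close> (or of \<open>complex^'n\<close> after complexification), bilinear forms \<open>B\<close> are matrices with
  \<open>B $ i $ j = B(e\<^sub>i, e\<^sub>j)\<close>, and an endomorphism \<open>A\<close> acts by \<open>A *v X\<close>.
\<close>

subsection \<open>Calculus in a chart\<close>

definition pd :: "'n::finite \<Rightarrow> (real^'n \<Rightarrow> 'b::real_normed_vector) \<Rightarrow> real^'n \<Rightarrow> 'b" where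
  "pd i f x = frechet_derivative f (at x) (axis i 1)"

primrec Ck_on :: "nat \<Rightarrow> (real^'n::finite) set \<Rightarrow> (real^'n \<Rightarrow> 'b::real_normed_vector) \<Rightarrow> bool" where
  "Ck_on 0 U f \<longleftrightarrow> continuous_on U f"
| "Ck_on (Suc k) U f \<longleftrightarrow> (\<forall>x\<in>U. f differentiable (at x)) \<and> (\<forall>i. Ck_on k U (pd i f))"

text \<open>Only used on open sets.\<close>

definition smooth_on :: "(real^'n::finite) set \<Rightarrow> (real^'n \<Rightarrow> 'b::real_normed_vector) \<Rightarrow> bool" where
  "smooth_on U f \<longleftrightarrow> (\<forall>k. Ck_on k U f)"

definition differential :: "(real^'n::finite \<Rightarrow> real) \<Rightarrow> real^'n \<Rightarrow> real^'n" where
  "differential f x = (\<chi> i. pd i f x)"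

text \<open>The convention is \<open>\<alpha> \<and> \<beta> = \<alpha> \<otimes> \<beta> - \<beta> \<otimes> \<alpha>\<close>.\<close>

definition wedge :: "'a::comm_ring^'n \<Rightarrow> 'a^'n \<Rightarrow> 'a^'n^'n" where
  "wedge \<alpha> \<beta> = (\<chi> i j. \<alpha> $ i * \<beta> $ j - \<beta> $ i * \<alpha> $ j)"

definition closed_2form :: "(real^'n::finite) set \<Rightarrow> (real^'n \<Rightarrow> real^'n^'n) \<Rightarrow> bool" where
  "closed_2form U \<omega> \<longleftrightarrow> (\<forall>x\<in>U. \<forall>i j k.
     pd i (\<lambda>y. \<omega> y $ j $ k) x + pd j (\<lambda>y. \<omega> y $ k $ i) x + pd k (\<lambda>y. \<omega> y $ i $ j) x = 0)"

subsection \<open>Complex distributions and complex structures\<close>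

definition lie_bracket ::
  "(real^'n::finite \<Rightarrow> complex^'n) \<Rightarrow> (real^'n \<Rightarrow> complex^'n) \<Rightarrow> real^'n \<Rightarrow> complex^'n" where
  "lie_bracket X Y x = (\<Sum>i\<in>UNIV. X x $ i *s pd i Y x - Y x $ i *s pd i X x)"

text \<open>\<open>[D, D] \<subseteq> D\<close> is a statement about local sections, hence the quantification over open subsets.\<close>

definition integrable_distribution ::
  "(real^'n::finite) set \<Rightarrow> (real^'n \<Rightarrow> (complex^'n) set) \<Rightarrow> bool" where
  "integrable_distribution V D \<longleftrightarrow>
     (\<forall>W X Y. open W \<and> W \<subseteq> V \<and> smooth_on W X \<and> smooth_on W Y \<and>
        (\<forall>x\<in>W. X x \<in> D x) \<and> (\<forall>x\<in>W. Y x \<in> D x) \<longrightarrow>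
        (\<forall>x\<in>W. lie_bracket X Y x \<in> D x))"

definition T10 :: "real^'n^'n::finite \<Rightarrow> (complex^'n) set" where
  "T10 J = {v. map_matrix complex_of_real J *v v = \<i> *s v}"

text \<open>An integrable almost complex structure.\<close>

definition complex_structure :: "(real^'n::finite) set \<Rightarrow> (real^'n \<Rightarrow> real^'n^'n) \<Rightarrow> bool" where
  "complex_structure U J \<longleftrightarrow> smooth_on U J \<and> (\<forall>x\<in>U. J x ** J x = - mat 1) \<and>
     integrable_distribution U (\<lambda>x. T10 (J x))"

subsection \<open>Kaehler structures\<close>

definition riemannian_metric :: "(real^'n::finite) set \<Rightarrow> (real^'n \<Rightarrow> real^'n^'n) \<Rightarrow> bool" where
  "riemannian_metric U g \<longleftrightarrow> smooth_on U g \<and>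
     (\<forall>x\<in>U. transpose (g x) = g x \<and> (\<forall>v. v \<noteq> 0 \<longrightarrow> v \<bullet> (g x *v v) > 0))"

definition orthogonal_structure ::
  "(real^'n::finite) set \<Rightarrow> (real^'n \<Rightarrow> real^'n^'n) \<Rightarrow> (real^'n \<Rightarrow> real^'n^'n) \<Rightarrow> bool" where
  "orthogonal_structure U g J \<longleftrightarrow>
     (\<forall>x\<in>U. \<forall>v w. (J x *v v) \<bullet> (g x *v (J x *v w)) = v \<bullet> (g x *v w))"

definition kaehler :: "(real^'n::finite) set \<Rightarrow> (real^'n \<Rightarrow> real^'n^'n) \<Rightarrow>
    (real^'n \<Rightarrow> real^'n^'n) \<Rightarrow> (real^'n \<Rightarrow> real^'n^'n) \<Rightarrow> bool" where
  "kaehler U g J \<omega> \<longleftrightarrow> riemannian_metric U g \<and> complex_structure U J \<and>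
     orthogonal_structure U g J \<and>
     (\<forall>x\<in>U. \<forall>i j. \<omega> x $ i $ j = (J x *v axis i 1) \<bullet> (g x *v axis j 1)) \<and>
     closed_2form U \<omega>"

subsection \<open>Levi-Civita connection\<close>

definition christoffel ::
  "(real^'n::finite \<Rightarrow> real^'n^'n) \<Rightarrow> real^'n \<Rightarrow> 'n \<Rightarrow> 'n \<Rightarrow> 'n \<Rightarrow> real" where
  "christoffel g x l i j = (\<Sum>k\<in>UNIV. matrix_inv (g x) $ l $ k *
     (pd i (\<lambda>y. g y $ j $ k) x + pd j (\<lambda>y. g y $ i $ k) x - pd k (\<lambda>y. g y $ i $ j) x)) / 2"

text \<open>\<open>cov_deriv g \<psi> x X\<close> is \<open>\<nabla>\<^sub>X \<psi>\<close> at the point \<open>x\<close>; it depends on \<open>X\<close> only through its value at \<open>x\<close>.\<close>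

definition cov_deriv ::
  "(real^'n::finite \<Rightarrow> real^'n^'n) \<Rightarrow> (real^'n \<Rightarrow> real^'n^'n) \<Rightarrow> real^'n \<Rightarrow> real^'n \<Rightarrow> real^'n^'n" where
  "cov_deriv g \<psi> x X = (\<chi> i j. \<Sum>k\<in>UNIV. X $ k *
     (pd k (\<lambda>y. \<psi> y $ i $ j) x
      - (\<Sum>l\<in>UNIV. christoffel g x l k i * \<psi> x $ l $ j)
      - (\<Sum>l\<in>UNIV. christoffel g x l k j * \<psi> x $ i $ l)))"

subsection \<open>Hamiltonian 2-forms\<close>

text \<open>The index operations below are pointwise: \<open>G\<close> is the metric at a point and \<open>J\<close> an endomorphism.\<close>

definition flat :: "real^'n^'n::finite \<Rightarrow> real^'n \<Rightarrow> real^'n" where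
  "flat G X = G *v X"

definition sharp :: "real^'n^'n::finite \<Rightarrow> real^'n \<Rightarrow> real^'n" where
  "sharp G \<alpha> = matrix_inv G *v \<alpha>"

definition J_form :: "real^'n^'n::finite \<Rightarrow> real^'n^'n \<Rightarrow> real^'n \<Rightarrow> real^'n" where
  "J_form G J \<alpha> = flat G (J *v sharp G \<alpha>)"

text \<open>
  The inner product of 2-forms, normalised by \<open>\<langle>\<alpha> \<and> \<beta>, \<alpha> \<and> \<beta>\<rangle> = 1\<close> for orthonormal \<open>\<alpha>, \<beta>\<close>. This is the
  normalisation under which the equation for a Hamiltonian 2-form is consistent with
  \<open>\<sigma> = \<langle>\<psi>, \<omega>\<rangle>\<close>: contracting that equation with \<open>\<omega>\<close> yields \<open>X \<sigma> = d\<sigma>(X)\<close>.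
\<close>

definition inner_2form :: "real^'n^'n::finite \<Rightarrow> real^'n^'n \<Rightarrow> real^'n^'n \<Rightarrow> real" where
  "inner_2form G \<psi> \<omega> = (\<Sum>i\<in>UNIV. \<Sum>j\<in>UNIV. \<Sum>k\<in>UNIV. \<Sum>l\<in>UNIV.
     matrix_inv G $ i $ k * matrix_inv G $ j $ l * \<psi> $ i $ j * \<omega> $ k $ l) / 2"

definition hamiltonian_2form :: "(real^'n::finite) set \<Rightarrow> (real^'n \<Rightarrow> real^'n^'n) \<Rightarrow>
    (real^'n \<Rightarrow> real^'n^'n) \<Rightarrow> (real^'n \<Rightarrow> real^'n^'n) \<Rightarrow> (real^'n \<Rightarrow> real^'n^'n) \<Rightarrow> bool" where
  "hamiltonian_2form U g J \<omega> \<psi> \<longleftrightarrow> smooth_on U \<psi> \<and>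
     (\<forall>x\<in>U. transpose (\<psi> x) = - \<psi> x \<and> transpose (J x) ** \<psi> x ** J x = \<psi> x) \<and>
     (let \<sigma> = (\<lambda>y. inner_2form (g y) (\<psi> y) (\<omega> y)) in
        \<forall>x\<in>U. \<forall>X. cov_deriv g \<psi> x X = (1/2) *\<^sub>R
          (wedge (differential \<sigma> x) (J_form (g x) (J x) (flat (g x) X))
           - wedge (J_form (g x) (J x) (differential \<sigma> x)) (flat (g x) X)))"

text \<open>The endomorphism \<open>A\<close> with \<open>g(A v, w) = \<psi>(v, w)\<close>.\<close>

definition raise_index :: "real^'n^'n::finite \<Rightarrow> real^'n^'n \<Rightarrow> real^'n^'n" where
  "raise_index G \<psi> = matrix_inv G ** transpose \<psi>"

definition eigenvalues :: "real^'n^'n::finite \<Rightarrow> complex set" where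
  "eigenvalues A = {c. \<exists>v. v \<noteq> 0 \<and> map_matrix complex_of_real A *v v = c *s v}"

definition nondegenerate_2form ::
  "(real^'n::finite) set \<Rightarrow> (real^'n \<Rightarrow> real^'n^'n) \<Rightarrow> (real^'n \<Rightarrow> real^'n^'n) \<Rightarrow> bool" where
  "nondegenerate_2form U g \<psi> \<longleftrightarrow> (\<forall>x\<in>U. invertible (raise_index (g x) (\<psi> x)))"

definition has_distinct_eigenvalues ::
  "(real^'n::finite) set \<Rightarrow> (real^'n \<Rightarrow> real^'n^'n) \<Rightarrow> (real^'n \<Rightarrow> real^'n^'n) \<Rightarrow> bool" where
  "has_distinct_eigenvalues U g \<psi> \<longleftrightarrow>
     (\<forall>x\<in>U. card (eigenvalues (raise_index (g x) (\<psi> x))) = CARD('n))"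

subsection \<open>The maximal isotropic distributions of a 2-form\<close>

definition conj_form :: "complex^'n::finite \<Rightarrow> complex^'n" where
  "conj_form \<alpha> = (\<chi> i. cnj (\<alpha> $ i))"

definition form_apply :: "complex^'n::finite \<Rightarrow> complex^'n \<Rightarrow> complex" where
  "form_apply \<alpha> v = (\<Sum>i\<in>UNIV. \<alpha> $ i * v $ i)"

text \<open>
  The \<open>2m\<close> forms are \<open>\<theta> \<mu>\<close> and \<open>conj_form (\<theta> \<mu>)\<close> for \<open>\<mu> = 1, \<dots>, m\<close>. The normalisation of \<open>g\<close> is the
  one for which \<open>\<lambda> \<mu>\<close> and \<open>- \<lambda> \<mu>\<close> are the eigenvalues of \<open>raise_index g \<psi>\<close>; as \<open>\<psi>\<close> is real, they are
  imaginary. That the \<open>2m\<close> forms are linearly independent follows from the nondegeneracy of \<open>g\<close> in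
  dimension \<open>2m\<close>.
\<close>

definition adapted_null_coframe :: "(real^'n::finite) set \<Rightarrow> nat \<Rightarrow> (real^'n \<Rightarrow> real^'n^'n) \<Rightarrow>
    (real^'n \<Rightarrow> real^'n^'n) \<Rightarrow> (nat \<Rightarrow> real^'n \<Rightarrow> complex) \<Rightarrow> (nat \<Rightarrow> real^'n \<Rightarrow> complex^'n) \<Rightarrow> bool" where
  "adapted_null_coframe V m g \<psi> lam \<theta> \<longleftrightarrow>
     (\<forall>\<mu>\<in>{1..m}. smooth_on V (\<theta> \<mu>)) \<and>
     (\<forall>x\<in>V. \<forall>i j. complex_of_real (g x $ i $ j) =
        (\<Sum>\<mu>=1..m. \<theta> \<mu> x $ i * conj_form (\<theta> \<mu> x) $ j + conj_form (\<theta> \<mu> x) $ i * \<theta> \<mu> x $ j)) \<and>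
     (\<forall>x\<in>V. map_matrix complex_of_real (\<psi> x) =
        (\<Sum>\<mu>=1..m. map_matrix ((*) (lam \<mu> x)) (wedge (\<theta> \<mu> x) (conj_form (\<theta> \<mu> x)))))"

definition isotropic :: "real^'n^'n::finite \<Rightarrow> (complex^'n) set \<Rightarrow> bool" where
  "isotropic G L \<longleftrightarrow>
     (\<forall>v\<in>L. \<forall>w\<in>L. (\<Sum>i\<in>UNIV. \<Sum>j\<in>UNIV. complex_of_real (G $ i $ j) * v $ i * w $ j) = 0)"

definition annihilator :: "nat \<Rightarrow> (nat \<Rightarrow> complex^'n::finite) \<Rightarrow> nat set \<Rightarrow> (complex^'n) set" where
  "annihilator m \<theta> S = {v. \<forall>\<mu>\<in>{1..m}. form_apply (if \<mu> \<in> S then \<theta> \<mu> else conj_form (\<theta> \<mu>)) v = 0}"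

text \<open>
  Distributions and complex structures on \<open>V\<close> are made extensional (undefined outside \<open>V\<close>) so that they
  can be counted.
\<close>

definition isotropic_distributions :: "(real^'n::finite) set \<Rightarrow> nat \<Rightarrow> (real^'n \<Rightarrow> real^'n^'n) \<Rightarrow>
    (nat \<Rightarrow> real^'n \<Rightarrow> complex^'n) \<Rightarrow> (real^'n \<Rightarrow> (complex^'n) set) set" where
  "isotropic_distributions V m g \<theta> =
     {D \<in> extensional V.
        (\<forall>x\<in>V. vec.subspace (D x) \<and> vec.dim (D x) = m \<and> isotropic (g x) (D x)) \<and>
        (\<exists>S\<subseteq>{1..m}. \<forall>x\<in>V. D x = annihilator m (\<lambda>\<mu>. \<theta> \<mu> x) S)}"

definition defines_complex_structure :: "(real^'n::finite) set \<Rightarrow> (real^'n \<Rightarrow> real^'n^'n) \<Rightarrow>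
    (real^'n \<Rightarrow> (complex^'n) set) \<Rightarrow> (real^'n \<Rightarrow> real^'n^'n) \<Rightarrow> bool" where
  "defines_complex_structure V g D I \<longleftrightarrow> I \<in> extensional V \<and> complex_structure V I \<and>
     orthogonal_structure V g I \<and> (\<forall>x\<in>V. T10 (I x) = D x)"

end

theory Submission
  imports Defs
begin

text \<open>
  Choose one form from each conjugate pair of an adapted null coframe and let \<open>D\<close> be the distribution that
  the chosen forms annihilate. Interchanging \<open>\<theta> \<mu>\<close> with its conjugate only changes the sign of \<open>\<lambda> \<mu>\<close>, so
  suppose that the chosen forms are \<open>\<theta> 1, \<dots>, \<theta> m\<close>. Their metric duals \<open>e \<mu>\<close> span \<open>D\<close>, and they are
  eigenvectors of the endomorphism \<open>A\<close> obtained from \<open>\<psi>\<close>.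

  For \<open>X\<close> in \<open>D\<close>, differentiate the identities \<open>g(e \<nu>, e \<rho>) = 0\<close> and \<open>\<psi>(e \<nu>, e \<rho>) = 0\<close> covariantly. Up to sign
  the result is \<open>(\<lambda> \<nu> + \<lambda> \<rho>) g(\<nabla>\<^sub>X e \<nu>, e \<rho>) = (\<nabla>\<^sub>X \<psi>)(e \<nu>, e \<rho>)\<close>. Since the \<open>2m\<close> eigenvalues \<open>\<plusminus>\<lambda> \<mu>\<close> are
  distinct, the sum \<open>\<lambda> \<nu> + \<lambda> \<rho>\<close> is never zero (\<open>eigenvalue_sum_nonzero\<close>). In the equation for a Hamiltonian
  2-form each term of \<open>\<nabla>\<^sub>X \<psi>\<close> contains the form \<open>g(X, -)\<close> or \<open>g(JX, -)\<close>. Both vanish on \<open>D\<close>: the distribution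
  is isotropic, and \<open>J\<close> preserves it because \<open>J\<close> commutes with \<open>A\<close>, whose eigenspaces are lines
  (\<open>D_invariant\<close>). Hence \<open>g(\<nabla>\<^sub>X e \<nu>, e \<rho>) = 0\<close>, and as \<open>D\<close> is its own orthogonal complement, \<open>D\<close> is closed
  under \<open>\<nabla>\<^sub>X\<close> for all \<open>X\<close> in \<open>D\<close> (\<open>geodesic\<close>). The connection has no torsion, so \<open>D\<close> is integrable
  (\<open>integrable\<close>). The formal argument is dual to this one and differentiates the forms \<open>\<theta> \<mu>\<close> instead of the
  vectors \<open>e \<mu>\<close>, using that \<open>g\<close> and \<open>\<psi>\<close> are given as sums over the coframe.

  The complex structure that belongs to \<open>D\<close> acts as \<open>i\<close> on \<open>D\<close> and as \<open>-i\<close> on its conjugate. This operator is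
  real, orthogonal and smooth, and it is determined by \<open>D\<close> (\<open>T10_determines\<close>). Different choices of forms
  give distributions that differ at every point (\<open>Dist_inj\<close>), which yields the number \<open>2 ^ m\<close>.

  For the existence of an adapted coframe near a point, \<open>A\<close> is skew, so its eigenvalues are imaginary, and
  eigenvectors to different eigenvalues are orthogonal for the Hermitian extension of \<open>g\<close>. What needs proof
  is that eigenvectors to simple eigenvalues can be chosen to depend smoothly on the point. This follows
  from the inverse function theorem, which gives one derivative, and from the equation itself, which then
  gives all the others (\<open>smooth_implicit_eigenvector\<close>).
\<close>

section \<open>Smooth maps on an open set of a coordinate space\<close>

lemma pd_eqI: "(f has_derivative D) (at x) \<Longrightarrow> pd i f x = D (axis i 1)"
  by (metis frechet_derivative_at pd_def)

lemma has_derivative_cong_open: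
  assumes "open U" "x \<in> U" "\<And>y. y \<in> U \<Longrightarrow> f y = g y"
  shows "(f has_derivative D) (at x) \<longleftrightarrow> (g has_derivative D) (at x)"
  using assms has_derivative_transform_within_open by metis

lemma differentiable_cong_open:
  assumes "open U" "x \<in> U" "\<And>y. y \<in> U \<Longrightarrow> f y = g y"
  shows "f differentiable (at x) \<longleftrightarrow> g differentiable (at x)"
  using has_derivative_cong_open[OF assms] by (auto simp: differentiable_def)

lemma pd_cong_open:
  assumes "open U" "x \<in> U" "\<And>y. y \<in> U \<Longrightarrow> f y = g y"
  shows "pd i f x = pd i g x"
  using has_derivative_cong_open[OF assms] by (simp add: pd_def frechet_derivative_def)

lemma pd_has_derivative:
  assumes "f differentiable (at x)"
  shows "(f has_derivative frechet_derivative f (at x)) (at x)"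
  using assms frechet_derivative_works by blast

lemma pd_const [simp]: "pd i (\<lambda>y. c) x = 0"
  by (simp add: pd_def)

lemma pd_add:
  assumes "f differentiable (at x)" "g differentiable (at x)"
  shows "pd i (\<lambda>y. f y + g y) x = pd i f x + pd i g x"
  using pd_eqI[OF has_derivative_add[OF pd_has_derivative[OF assms(1)] pd_has_derivative[OF assms(2)]]]
  by (simp add: pd_def)

lemma pd_sum:
  assumes "\<And>a. a \<in> A \<Longrightarrow> f a differentiable (at x)"
  shows "pd i (\<lambda>y. \<Sum>a\<in>A. f a y) x = (\<Sum>a\<in>A. pd i (f a) x)"
  using pd_eqI[OF has_derivative_sum[OF pd_has_derivative[OF assms]]]
  by (simp add: pd_def)

lemma pd_linear:
  assumes "bounded_linear L" "f differentiable (at x)"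
  shows "pd i (\<lambda>y. L (f y)) x = L (pd i f x)"
  using pd_eqI[OF bounded_linear.has_derivative[OF assms(1) pd_has_derivative[OF assms(2)]]]
  by (simp add: pd_def)

lemma pd_bilinear:
  assumes "bounded_bilinear B" "f differentiable (at x)" "g differentiable (at x)"
  shows "pd i (\<lambda>y. B (f y) (g y)) x = B (f x) (pd i g x) + B (pd i f x) (g x)"
  using pd_eqI[OF bounded_bilinear.FDERIV[OF assms(1) pd_has_derivative[OF assms(2)]
        pd_has_derivative[OF assms(3)]]]
  by (simp add: pd_def)

lemma differentiable_bilinear:
  assumes "bounded_bilinear B" "f differentiable (at x)" "g differentiable (at x)"
  shows "(\<lambda>y. B (f y) (g y)) differentiable (at x)"
  using bounded_bilinear.FDERIV[OF assms(1) pd_has_derivative[OF assms(2)] pd_has_derivative[OF assms(3)]]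
  unfolding differentiable_def by blast

lemma differentiable_linear:
  assumes "bounded_linear L" "f differentiable (at x)"
  shows "(\<lambda>y. L (f y)) differentiable (at x)"
  using bounded_linear.has_derivative[OF assms(1) pd_has_derivative[OF assms(2)]]
  unfolding differentiable_def by blast

lemma pd_mult:
  fixes f g :: "real^'n \<Rightarrow> 'a::real_normed_algebra"
  assumes "f differentiable (at x)" "g differentiable (at x)"
  shows "pd i (\<lambda>y. f y * g y) x = f x * pd i g x + pd i f x * g x"
  by (rule pd_bilinear[OF bounded_bilinear_mult assms])

lemma Ck_on_cong:
  assumes "open U" "\<And>x. x \<in> U \<Longrightarrow> f x = g x"
  shows "Ck_on k U f \<longleftrightarrow> Ck_on k U g"
  using assms(2)
proof (induction k arbitrary: f g)
  case 0
  then show ?case by (simp cong: continuous_on_cong)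
next
  case (Suc k)
  have "\<And>x. x \<in> U \<Longrightarrow> f differentiable (at x) \<longleftrightarrow> g differentiable (at x)"
    using differentiable_cong_open[OF assms(1)] Suc.prems by blast
  moreover have "Ck_on k U (pd i f) \<longleftrightarrow> Ck_on k U (pd i g)" for i
    by (intro Suc.IH pd_cong_open[OF assms(1)] Suc.prems)
  ultimately show ?case by simp
qed

lemma Ck_on_subset: "Ck_on k U f \<Longrightarrow> W \<subseteq> U \<Longrightarrow> Ck_on k W f"
  by (induction k arbitrary: f) (auto intro: continuous_on_subset)

lemma Ck_on_Suc_imp: "Ck_on (Suc k) U f \<Longrightarrow> Ck_on k U f"
proof (induction k arbitrary: f)
  case 0
  then show ?case
    by (simp add: continuous_at_imp_continuous_on differentiable_imp_continuous_within)
next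
  case (Suc k)
  then show ?case by (metis Ck_on.simps(2))
qed

lemma Ck_on_const: "Ck_on k U (\<lambda>x. c)"
proof (induction k arbitrary: c)
  case (Suc k)
  have "pd i (\<lambda>x. c) = (\<lambda>x. 0)" for i :: 'a by (simp add: fun_eq_iff)
  then show ?case using Suc by simp
qed simp

lemma Ck_on_add:
  assumes "open U" "Ck_on k U f" "Ck_on k U g"
  shows "Ck_on k U (\<lambda>x. f x + g x)"
  using assms(2,3)
proof (induction k arbitrary: f g)
  case 0
  then show ?case by (auto intro: continuous_intros)
next
  case (Suc k)
  have "Ck_on k U (pd i (\<lambda>x. f x + g x))" for i
    by (subst Ck_on_cong[OF assms(1), of _ "\<lambda>x. pd i f x + pd i g x"])
      (use Suc in \<open>auto simp: pd_add\<close>)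
  then show ?case using Suc.prems by simp
qed

lemma Ck_on_linear:
  assumes "open U" "bounded_linear L" "Ck_on k U f"
  shows "Ck_on k U (\<lambda>x. L (f x))"
  using assms(3)
proof (induction k arbitrary: f)
  case 0
  then show ?case by (simp add: bounded_linear.continuous_on[OF assms(2)])
next
  case (Suc k)
  have "Ck_on k U (pd i (\<lambda>x. L (f x)))" for i
    by (subst Ck_on_cong[OF assms(1), of _ "\<lambda>x. L (pd i f x)"])
      (use Suc in \<open>auto simp: pd_linear[OF assms(2)]\<close>)
  then show ?case using Suc.prems by (auto intro: differentiable_linear[OF assms(2)])
qed

lemma Ck_on_bilinear:
  assumes "open U" "bounded_bilinear B" "Ck_on k U f" "Ck_on k U g"
  shows "Ck_on k U (\<lambda>x. B (f x) (g x))"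
  using assms(3,4)
proof (induction k arbitrary: f g)
  case 0
  then show ?case by (simp add: bounded_bilinear.continuous_on[OF assms(2)])
next
  case (Suc k)
  have "Ck_on k U (pd i (\<lambda>x. B (f x) (g x)))" for i
    by (subst Ck_on_cong[OF assms(1), of _ "\<lambda>x. B (f x) (pd i g x) + B (pd i f x) (g x)"])
      (use Suc.prems Ck_on_Suc_imp[OF Suc.prems(1)] Ck_on_Suc_imp[OF Suc.prems(2)]
        in \<open>auto simp: pd_bilinear[OF assms(2)] intro!: Ck_on_add[OF assms(1)] Suc.IH\<close>)
  then show ?case using Suc.prems by (auto intro: differentiable_bilinear[OF assms(2)])
qed

lemma Ck_on_uminus: "open U \<Longrightarrow> Ck_on k U f \<Longrightarrow> Ck_on k U (\<lambda>x. - f x)"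
  by (rule Ck_on_linear[OF _ bounded_linear_minus[OF bounded_linear_ident]])

lemma Ck_on_diff:
  assumes "open U" "Ck_on k U f" "Ck_on k U g"
  shows "Ck_on k U (\<lambda>x. f x - g x)"
  using Ck_on_add[OF assms(1,2) Ck_on_uminus[OF assms(1,3)]] by simp

lemma Ck_on_sum:
  assumes "open U" "\<And>a. a \<in> A \<Longrightarrow> Ck_on k U (f a)"
  shows "Ck_on k U (\<lambda>x. \<Sum>a\<in>A. f a x)"
  using assms(2) by (induction A rule: infinite_finite_induct) (auto intro: Ck_on_const Ck_on_add[OF assms(1)])

lemma Ck_on_mult:
  fixes f g :: "real^'n \<Rightarrow> 'a::real_normed_algebra"
  assumes "open U" "Ck_on k U f" "Ck_on k U g"
  shows "Ck_on k U (\<lambda>x. f x * g x)"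
  by (rule Ck_on_bilinear[OF assms(1) bounded_bilinear_mult assms(2,3)])

lemma Ck_on_prod:
  fixes f :: "'b \<Rightarrow> real^'n \<Rightarrow> 'a::real_normed_field"
  assumes "open U" "\<And>a. a \<in> A \<Longrightarrow> Ck_on k U (f a)"
  shows "Ck_on k U (\<lambda>x. \<Prod>a\<in>A. f a x)"
  using assms(2) by (induction A rule: infinite_finite_induct) (auto intro: Ck_on_const Ck_on_mult[OF assms(1)])

lemma Ck_on_inverse:
  fixes f :: "real^'n \<Rightarrow> 'a::real_normed_field"
  assumes "open U" "Ck_on k U f" "\<And>x. x \<in> U \<Longrightarrow> f x \<noteq> 0"
  shows "Ck_on k U (\<lambda>x. inverse (f x))"
  using assms(2)
proof (induction k)
  case 0
  then show ?case using assms(3) by (simp add: continuous_on_inverse)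
next
  case (Suc k)
  have d: "((\<lambda>x. inverse (f x)) has_derivative
      (\<lambda>h. - (inverse (f x) * frechet_derivative f (at x) h * inverse (f x)))) (at x)" if "x \<in> U" for x
    using that Suc.prems assms(3) by (intro Deriv.has_derivative_inverse pd_has_derivative) auto
  have *: "pd i (\<lambda>x. inverse (f x)) x = - (inverse (f x) * pd i f x * inverse (f x))" if "x \<in> U" for x i
    using pd_eqI[OF d[OF that]] by (simp add: pd_def)
  have "Ck_on k U (pd i (\<lambda>x. inverse (f x)))" for i
    by (subst Ck_on_cong[OF assms(1) *], assumption)
      (use Suc Ck_on_Suc_imp[OF Suc.prems] in \<open>auto intro!: Ck_on_mult Ck_on_uminus assms(1)\<close>)
  then show ?case using d by (auto simp: differentiable_def)
qed

lemma Ck_on_vec: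
  assumes "open U" "\<And>i. Ck_on k U (\<lambda>x. f x $ i)"
  shows "Ck_on k U (f :: real^'n \<Rightarrow> 'b::real_normed_vector^'m)"
proof -
  have "norm (axis i y :: 'b^'m) = norm y" for i and y :: 'b
  proof -
    have "(\<Sum>j\<in>UNIV. (norm ((axis i y :: 'b^'m) $ j))\<^sup>2) = (\<Sum>j\<in>UNIV. if j = i then (norm y)\<^sup>2 else 0)"
      by (intro sum.cong) (auto simp: axis_def)
    then show ?thesis by (simp add: norm_vec_def L2_set_def)
  qed
  then have "bounded_linear (axis i :: 'b \<Rightarrow> 'b^'m)" for i
    by (intro bounded_linear_intro[where K=1]) (simp_all add: vec_eq_iff axis_def)
  then have "Ck_on k U (\<lambda>x. \<Sum>i\<in>UNIV. axis i (f x $ i))"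
    by (intro Ck_on_sum[OF assms(1)] Ck_on_linear[OF assms(1) _ assms(2)])
  moreover have "(\<Sum>i\<in>UNIV. axis i (f x $ i)) = f x" for x
    by (simp add: vec_eq_iff axis_def if_distrib cong: if_cong)
  ultimately show ?thesis by simp
qed

lemma Ck_on_nth: "open U \<Longrightarrow> Ck_on k U f \<Longrightarrow> Ck_on k U (\<lambda>x. f x $ i)"
  by (rule Ck_on_linear[OF _ bounded_linear_vec_nth])

lemma Ck_on_det:
  fixes A :: "real^'n \<Rightarrow> 'a::real_normed_field^'m^'m"
  assumes "open U" "\<And>i j. Ck_on k U (\<lambda>x. A x $ i $ j)"
  shows "Ck_on k U (\<lambda>x. det (A x))"
  unfolding det_def by (intro Ck_on_sum Ck_on_mult Ck_on_prod Ck_on_const assms)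

text \<open>By Cramer's rule the solution is a rational function of the data.\<close>

lemma Ck_on_solution:
  fixes A :: "real^'n \<Rightarrow> 'a::real_normed_field^'m^'m"
  assumes "open U" "\<And>i j. Ck_on k U (\<lambda>x. A x $ i $ j)" "\<And>i. Ck_on k U (\<lambda>x. b x $ i)"
    and "\<And>x. x \<in> U \<Longrightarrow> det (A x) \<noteq> 0" "\<And>x. x \<in> U \<Longrightarrow> A x *v w x = b x"
  shows "Ck_on k U w"
proof (rule Ck_on_vec[OF assms(1)])
  fix i
  have "w x $ i = det (\<chi> r j. if j = i then b x $ r else A x $ r $ j) * inverse (det (A x))"
    if "x \<in> U" for x
    using cramer[OF assms(4)[OF that], of "w x" "b x"] assms(5)[OF that]
    by (simp add: divide_inverse)
  moreover have "Ck_on k U (\<lambda>x. if j = i then b x $ r else A x $ r $ j)" for r j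
    using assms by (cases "j = i") auto
  then have "Ck_on k U (\<lambda>x. det (\<chi> r j. if j = i then b x $ r else A x $ r $ j) * inverse (det (A x)))"
    by (intro Ck_on_mult Ck_on_inverse Ck_on_det assms) auto
  ultimately show "Ck_on k U (\<lambda>x. w x $ i)"
    using Ck_on_cong[OF assms(1)] by (metis (no_types, lifting))
qed

lemma smooth_on_differentiable: "smooth_on U f \<Longrightarrow> x \<in> U \<Longrightarrow> f differentiable (at x)"
  unfolding smooth_on_def by (metis Ck_on.simps(2))

lemma smooth_on_continuous: "smooth_on U f \<Longrightarrow> continuous_on U f"
  unfolding smooth_on_def by (metis Ck_on.simps(1))

lemma smooth_on_pd: "smooth_on U f \<Longrightarrow> smooth_on U (pd i f)"
  unfolding smooth_on_def by (metis Ck_on.simps(2))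

lemma smooth_on_subset: "smooth_on U f \<Longrightarrow> W \<subseteq> U \<Longrightarrow> smooth_on W f"
  unfolding smooth_on_def using Ck_on_subset by blast

lemma smooth_on_cong:
  "open U \<Longrightarrow> (\<And>x. x \<in> U \<Longrightarrow> f x = g x) \<Longrightarrow> smooth_on U f \<longleftrightarrow> smooth_on U g"
  unfolding smooth_on_def using Ck_on_cong by blast

lemma smooth_on_const: "smooth_on U (\<lambda>x. c)"
  by (simp add: smooth_on_def Ck_on_const)

lemma smooth_on_linear:
  "open U \<Longrightarrow> bounded_linear L \<Longrightarrow> smooth_on U f \<Longrightarrow> smooth_on U (\<lambda>x. L (f x))"
  by (simp add: smooth_on_def Ck_on_linear)

lemma smooth_on_sum:
  "open U \<Longrightarrow> (\<And>a. a \<in> A \<Longrightarrow> smooth_on U (f a)) \<Longrightarrow> smooth_on U (\<lambda>x. \<Sum>a\<in>A. f a x)"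
  by (simp add: smooth_on_def Ck_on_sum)

lemma smooth_on_mult:
  fixes f g :: "real^'n \<Rightarrow> 'a::real_normed_algebra"
  shows "open U \<Longrightarrow> smooth_on U f \<Longrightarrow> smooth_on U g \<Longrightarrow> smooth_on U (\<lambda>x. f x * g x)"
  by (simp add: smooth_on_def Ck_on_mult)

lemma smooth_on_inverse:
  fixes f :: "real^'n \<Rightarrow> 'a::real_normed_field"
  shows "open U \<Longrightarrow> smooth_on U f \<Longrightarrow> (\<And>x. x \<in> U \<Longrightarrow> f x \<noteq> 0) \<Longrightarrow> smooth_on U (\<lambda>x. inverse (f x))"
  by (simp add: smooth_on_def Ck_on_inverse)

lemma smooth_on_nth: "open U \<Longrightarrow> smooth_on U f \<Longrightarrow> smooth_on U (\<lambda>x. f x $ i)"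
  by (simp add: smooth_on_def Ck_on_nth)

lemma smooth_on_vec:
  fixes f :: "real^'n \<Rightarrow> 'b::real_normed_vector^'m"
  shows "open U \<Longrightarrow> (\<And>i. smooth_on U (\<lambda>x. f x $ i)) \<Longrightarrow> smooth_on U f"
  by (simp add: smooth_on_def Ck_on_vec)

lemma smooth_on_sqrt:
  assumes "open U" "smooth_on U f" "\<And>x. x \<in> U \<Longrightarrow> f x > 0"
  shows "smooth_on U (\<lambda>x. sqrt (f x))"
  unfolding smooth_on_def
proof
  fix k
  have d: "((\<lambda>x. sqrt (f x)) has_derivative
      (\<lambda>h. frechet_derivative f (at x) h * (inverse (sqrt (f x)) * inverse 2))) (at x)" if "x \<in> U" for x
    using that assms by (auto intro!: derivative_eq_intros pd_has_derivative smooth_on_differentiable)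
  have *: "pd i (\<lambda>x. sqrt (f x)) x = pd i f x * (inverse (sqrt (f x)) * inverse 2)" if "x \<in> U" for x i
    using pd_eqI[OF d[OF that]] by (simp add: pd_def)
  show "Ck_on k U (\<lambda>x. sqrt (f x))"
  proof (induction k)
    case 0
    then show ?case using smooth_on_continuous[OF assms(2)] by (auto intro: continuous_intros)
  next
    case (Suc k)
    have "Ck_on k U (pd i f)" for i
      using smooth_on_pd[OF assms(2)] by (simp add: smooth_on_def)
    moreover have "Ck_on k U (\<lambda>x. inverse (sqrt (f x)))"
      using assms(3) by (intro Ck_on_inverse[OF assms(1) Suc]) force
    ultimately have "Ck_on k U (\<lambda>x. pd i f x * (inverse (sqrt (f x)) * inverse 2))" for i
      by (intro Ck_on_mult[OF assms(1)] Ck_on_const)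
    then have "Ck_on k U (pd i (\<lambda>x. sqrt (f x)))" for i
      by (subst Ck_on_cong[OF assms(1) *])
    then show ?case using d by (auto simp: differentiable_def)
  qed
qed

lemma invertible_matrix_inv:
  fixes A :: "'a::semiring_1^'n^'n"
  assumes "invertible A"
  shows "A ** matrix_inv A = mat 1" "matrix_inv A ** A = mat 1"
  using someI_ex[OF assms[unfolded invertible_def]] by (simp_all add: matrix_inv_def)

lemma smooth_on_matrix_inv:
  fixes A :: "real^'n \<Rightarrow> 'a::real_normed_field^'m^'m"
  assumes "open U" "smooth_on U A" "\<And>x. x \<in> U \<Longrightarrow> invertible (A x)"
  shows "smooth_on U (\<lambda>x. matrix_inv (A x))"
proof -
  have "smooth_on U (\<lambda>x. matrix_inv (A x) *v axis j 1)" for j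
    unfolding smooth_on_def
  proof
    fix k
    have "A x *v (matrix_inv (A x) *v axis j 1) = axis j 1" if "x \<in> U" for x
      using invertible_matrix_inv(1)[OF assms(3)[OF that]] by (simp add: matrix_vector_mul_assoc)
    then show "Ck_on k U (\<lambda>x. matrix_inv (A x) *v axis j 1)"
      using assms
      by (intro Ck_on_solution[where A=A and b="\<lambda>x. axis j 1"])
        (auto simp: smooth_on_def invertible_det_nz intro!: Ck_on_const Ck_on_nth)
  qed
  from smooth_on_nth[OF assms(1) this]
  have "smooth_on U (\<lambda>x. matrix_inv (A x) $ i $ j)" for i j
    by (simp add: matrix_vector_mul_component inner_vec_def matrix_vector_mult_def axis_def if_distrib cong: if_cong)
  then show ?thesis using assms(1) by (intro smooth_on_vec) auto
qed

section \<open>Complexified bilinear forms and dual frames\<close>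

definition cbil :: "real^'n^'n::finite \<Rightarrow> complex^'n \<Rightarrow> complex^'n \<Rightarrow> complex" where
  "cbil B v w = (\<Sum>i\<in>UNIV. \<Sum>j\<in>UNIV. complex_of_real (B $ i $ j) * v $ i * w $ j)"

text \<open>The 1-form \<open>B(v, -)\<close>.\<close>

definition lower :: "real^'n^'n::finite \<Rightarrow> complex^'n \<Rightarrow> complex^'n" where
  "lower B v = (\<chi> j. \<Sum>i\<in>UNIV. complex_of_real (B $ i $ j) * v $ i)"

lemma form_apply_lower: "form_apply (lower B v) w = cbil B v w"
  unfolding form_apply_def lower_def cbil_def
  by (subst sum.swap) (simp add: sum_distrib_right)

lemma form_apply_linear_simps [simp]:
  "form_apply \<alpha> (v + w) = form_apply \<alpha> v + form_apply \<alpha> w"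
  "form_apply \<alpha> (c *s v) = c * form_apply \<alpha> v"
  "form_apply \<alpha> 0 = 0"
  "form_apply \<alpha> (v - w) = form_apply \<alpha> v - form_apply \<alpha> w"
  "form_apply \<alpha> (- v) = - form_apply \<alpha> v"
  "form_apply (\<alpha> + \<beta>) v = form_apply \<alpha> v + form_apply \<beta> v"
  "form_apply (\<alpha> - \<beta>) v = form_apply \<alpha> v - form_apply \<beta> v"
  "form_apply 0 v = 0"
  "form_apply (- \<alpha>) v = - form_apply \<alpha> v"
  "form_apply (k *s \<alpha>) v = k * form_apply \<alpha> v"
  by (simp_all add: form_apply_def algebra_simps sum.distrib sum_subtractf sum_negf sum_distrib_left)

lemma form_apply_sum: "form_apply \<alpha> (\<Sum>i\<in>A. f i) = (\<Sum>i\<in>A. form_apply \<alpha> (f i))"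
  by (induction A rule: infinite_finite_induct) auto

lemma form_apply_sum_left: "form_apply (\<Sum>i\<in>A. f i) v = (\<Sum>i\<in>A. form_apply (f i) v)"
  by (induction A rule: infinite_finite_induct) auto

lemma cbil_linear_simps [simp]:
  "cbil B v (w + z) = cbil B v w + cbil B v z"
  "cbil B v (c *s w) = c * cbil B v w"
  "cbil B v 0 = 0"
  by (simp_all flip: form_apply_lower)

lemma cbil_add_left [simp]: "cbil B (w + z) v = cbil B w v + cbil B z v"
  by (simp add: cbil_def algebra_simps sum.distrib)

lemma cbil_scale_left [simp]: "cbil B (c *s w) v = c * cbil B w v"
  by (simp add: cbil_def sum_distrib_left algebra_simps)

lemma cbil_zero_left [simp]: "cbil B 0 v = 0"
  by (simp add: cbil_def)

lemma cbil_sum_left: "cbil B (\<Sum>i\<in>A. f i) w = (\<Sum>i\<in>A. cbil B (f i) w)"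
  by (induction A rule: infinite_finite_induct) auto

lemma cbil_transpose: "cbil (transpose B) v w = cbil B w v"
  unfolding cbil_def by (subst sum.swap) (simp add: transpose_def mult_ac)

lemma cbil_sym: "transpose B = B \<Longrightarrow> cbil B v w = cbil B w v"
  by (metis cbil_transpose)

lemma cbil_skew:
  assumes "transpose B = - B"
  shows "cbil B v w = - cbil B w v"
proof -
  have "cbil B v w = cbil (- B) w v" by (metis assms cbil_transpose transpose_transpose)
  then show ?thesis by (simp add: cbil_def sum_negf)
qed

text \<open>Conjugation of components is used for vectors as well as for forms.\<close>

lemma conj_form_simps [simp]:
  "conj_form v $ i = cnj (v $ i)"
  "conj_form (conj_form v) = v"
  "conj_form v = 0 \<longleftrightarrow> v = 0"
  "conj_form (c *s v) = cnj c *s conj_form v"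
  by (simp_all add: conj_form_def vec_eq_iff)

lemma cnj_cbil: "cnj (cbil B v w) = cbil B (conj_form v) (conj_form w)"
  by (simp add: cbil_def)

lemma conj_form_lower: "conj_form (lower B v) = lower B (conj_form v)"
  by (simp add: lower_def vec_eq_iff)

lemma cbil_matrix_right: "cbil B v (map_matrix complex_of_real A *v w) = cbil (B ** A) v w"
proof -
  have "cbil B v (map_matrix complex_of_real A *v w)
      = (\<Sum>i\<in>UNIV. \<Sum>j\<in>UNIV. \<Sum>k\<in>UNIV. complex_of_real (B $ i $ j * A $ j $ k) * v $ i * w $ k)"
    by (simp add: cbil_def matrix_vector_mult_def sum_distrib_left mult_ac)
  also have "\<dots> = (\<Sum>i\<in>UNIV. \<Sum>k\<in>UNIV. \<Sum>j\<in>UNIV. complex_of_real (B $ i $ j * A $ j $ k) * v $ i * w $ k)"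
    by (intro sum.cong refl sum.swap)
  also have "\<dots> = cbil (B ** A) v w"
    by (simp add: cbil_def matrix_matrix_mult_def sum_distrib_right of_real_sum)
  finally show ?thesis .
qed

lemma sum_mult_axis:
  fixes x :: "'n::finite \<Rightarrow> 'a::semiring_1"
  shows "(\<Sum>k\<in>UNIV. x k * axis i 1 $ k) = x i"
proof -
  have "x k * axis i 1 $ k = (if k = i then x k else 0)" for k
    by (simp add: axis_def)
  then show ?thesis by simp
qed

lemma form_apply_axis: "form_apply \<alpha> (axis i 1) = \<alpha> $ i"
  by (simp add: form_apply_def sum_mult_axis)

lemma cbil_axis: "cbil B (axis i 1) (axis j 1) = complex_of_real (B $ i $ j)"
  by (simp only: form_apply_lower[symmetric] form_apply_axis) (simp add: lower_def sum_mult_axis)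

definition re_vec :: "complex^'n::finite \<Rightarrow> real^'n" where "re_vec v = (\<chi> i. Re (v $ i))"
definition im_vec :: "complex^'n::finite \<Rightarrow> real^'n" where "im_vec v = (\<chi> i. Im (v $ i))"

text \<open>The Hermitian extension of a metric is positive because its value at \<open>x + i y\<close> is the sum of
  the values at \<open>x\<close> and at \<open>y\<close>.\<close>

lemma cbil_hermitian_pos:
  assumes sym: "transpose G = G" and pos: "\<And>v. v \<noteq> 0 \<Longrightarrow> v \<bullet> (G *v v) > 0" and "v \<noteq> 0"
  shows "\<exists>r>0. cbil G v (conj_form v) = complex_of_real r"
proof -
  let ?r = "re_vec v \<bullet> (G *v re_vec v) + im_vec v \<bullet> (G *v im_vec v)"
  have "Re (cbil G v (conj_form v)) = ?r"
    by (simp add: cbil_def inner_vec_def matrix_vector_mult_def re_vec_def im_vec_def sum_distrib_left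
        flip: sum.distrib) (simp add: algebra_simps)
  moreover have "cnj (cbil G v (conj_form v)) = cbil G v (conj_form v)"
    using cbil_sym[OF sym] by (simp add: cnj_cbil)
  then have "Im (cbil G v (conj_form v)) = 0" by (simp add: complex_eq_iff)
  moreover have "?r > 0"
  proof -
    have "re_vec v \<noteq> 0 \<or> im_vec v \<noteq> 0"
      using \<open>v \<noteq> 0\<close> by (auto simp: vec_eq_iff re_vec_def im_vec_def complex_eq_iff)
    moreover have "w \<bullet> (G *v w) \<ge> 0" for w using pos[of w] by (cases "w = 0") auto
    ultimately show ?thesis using pos by (metis add_pos_nonneg add_nonneg_pos)
  qed
  ultimately show ?thesis by (intro exI[of _ ?r]) (simp add: complex_eq_iff)
qed

lemma metric_invertible:
  fixes G :: "real^'n^'n::finite"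
  assumes "\<And>v. v \<noteq> 0 \<Longrightarrow> v \<bullet> (G *v v) > 0"
  shows "invertible G"
proof -
  have "G *v v = 0 \<Longrightarrow> v = 0" for v using assms[of v] by force
  then show ?thesis
    by (metis invertible_left_inverse matrix_left_invertible_ker)
qed

text \<open>A square matrix with a one-sided inverse is invertible; read for the matrix whose rows are the
  forms and the one whose columns are the vectors, this says that spanning and duality are the same.\<close>

lemma dual_frame_iff:
  fixes \<alpha> u :: "'k \<Rightarrow> complex^'n::finite"
  assumes "finite I" "card I = CARD('n)"
  shows "(\<forall>y. y = (\<Sum>i\<in>I. form_apply (\<alpha> i) y *s u i)) \<longleftrightarrow>
    (\<forall>i\<in>I. \<forall>j\<in>I. form_apply (\<alpha> i) (u j) = (if i = j then 1 else 0))"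
proof -
  obtain h where h: "bij_betw h (UNIV :: 'n set) I"
    using assms by (metis finite_same_card_bij finite_class.finite_UNIV)
  define T :: "complex^'n^'n" where "T = (\<chi> r. \<alpha> (h r))"
  define S :: "complex^'n^'n" where "S = (\<chi> i c. u (h c) $ i)"
  have TS: "(T ** S) $ r $ c = form_apply (\<alpha> (h r)) (u (h c))" for r c
    by (simp add: T_def S_def matrix_matrix_mult_def form_apply_def)
  have ST: "(S ** T) *v y = (\<Sum>i\<in>I. form_apply (\<alpha> i) y *s u i)" for y
  proof -
    have "(S ** T) *v y = S *v (T *v y)" by (simp add: matrix_vector_mul_assoc)
    also have "\<dots> = (\<Sum>r\<in>UNIV. form_apply (\<alpha> (h r)) y *s u (h r))"
      by (simp add: vec_eq_iff S_def T_def matrix_vector_mult_def form_apply_def mult.commute)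
    also have "\<dots> = (\<Sum>i\<in>I. form_apply (\<alpha> i) y *s u i)"
      by (rule sum.reindex_bij_betw[OF h])
    finally show ?thesis .
  qed
  have "(\<forall>y. y = (\<Sum>i\<in>I. form_apply (\<alpha> i) y *s u i)) \<longleftrightarrow> S ** T = mat 1"
    using ST by (metis matrix_eq matrix_vector_mul_lid)
  also have "\<dots> \<longleftrightarrow> T ** S = mat 1"
    by (rule matrix_left_right_inverse)
  also have "\<dots> \<longleftrightarrow> (\<forall>r c. form_apply (\<alpha> (h r)) (u (h c)) = (if r = c then 1 else 0))"
    by (simp add: vec_eq_iff TS mat_def)
  also have "\<dots> \<longleftrightarrow> (\<forall>r c. form_apply (\<alpha> (h r)) (u (h c)) = (if h r = h c then 1 else 0))"
    using bij_betw_imp_inj_on[OF h] by (simp add: inj_eq)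
  also have "\<dots> \<longleftrightarrow> (\<forall>i\<in>I. \<forall>j\<in>I. form_apply (\<alpha> i) (u j) = (if i = j then 1 else 0))"
    unfolding bij_betw_imp_surj_on[OF h, symmetric] by simp
  finally show ?thesis .
qed

lemma null_frame_iff:
  fixes a c e f :: "nat \<Rightarrow> complex^'n::finite"
  assumes "CARD('n) = 2 * m"
  shows "(\<forall>y. y = (\<Sum>\<mu>=1..m. form_apply (a \<mu>) y *s f \<mu> + form_apply (c \<mu>) y *s e \<mu>)) \<longleftrightarrow>
    (\<forall>\<mu>\<in>{1..m}. \<forall>\<nu>\<in>{1..m}.
      form_apply (a \<mu>) (f \<nu>) = (if \<mu> = \<nu> then 1 else 0) \<and> form_apply (a \<mu>) (e \<nu>) = 0 \<and>
      form_apply (c \<mu>) (f \<nu>) = 0 \<and> form_apply (c \<mu>) (e \<nu>) = (if \<mu> = \<nu> then 1 else 0))"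
proof -
  let ?I = "{1..m} <+> {1..m}"
  have I: "finite ?I" "card ?I = CARD('n)" using assms by (auto simp: card_Plus)
  have "(\<Sum>\<mu>=1..m. form_apply (a \<mu>) y *s f \<mu> + form_apply (c \<mu>) y *s e \<mu>)
      = (\<Sum>i\<in>?I. form_apply (case_sum a c i) y *s case_sum f e i)" for y
    by (simp add: sum.Plus sum.distrib)
  then show ?thesis
    using dual_frame_iff[OF I, of "case_sum a c" "case_sum f e"] by (auto simp: ball_Un Plus_def)
qed

section \<open>Null coframes at a point\<close>

lemma map_matrix_mult:
  "map_matrix complex_of_real A *v (map_matrix complex_of_real B *v v) = map_matrix complex_of_real (A ** B) *v v"
proof -
  have "map_matrix complex_of_real A ** map_matrix complex_of_real B = map_matrix complex_of_real (A ** B)"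
    by (simp add: vec_eq_iff matrix_matrix_mult_def)
  then show ?thesis by (simp add: matrix_vector_mul_assoc)
qed

lemma map_matrix_mat_1 [simp]: "map_matrix complex_of_real (mat 1) *v v = v"
proof -
  have "map_matrix complex_of_real (mat 1) = (mat 1 :: complex^'a^'a)"
    by (simp add: vec_eq_iff mat_def)
  then show ?thesis by simp
qed

lemma lower_eq: "lower B v = map_matrix complex_of_real (transpose B) *v v"
  by (simp add: lower_def vec_eq_iff matrix_vector_mult_def transpose_def)

lemma cbil_matrix_left: "cbil B (map_matrix complex_of_real A *v v) w = cbil (transpose A ** B) v w"
proof -
  have "cbil B (map_matrix complex_of_real A *v v) w = cbil (transpose B ** A) w v"
    by (metis cbil_transpose cbil_matrix_right transpose_transpose)
  also have "\<dots> = cbil (transpose (transpose B ** A)) v w"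
    by (metis cbil_transpose)
  finally show ?thesis by (simp add: matrix_transpose_mul)
qed

text \<open>Raising an index turns the eigenvalue equation into an equality of 1-forms, which involves no
  inverse matrix.\<close>

lemma eigenvector_iff:
  assumes "invertible G" "transpose G = G"
  shows "map_matrix complex_of_real (raise_index G P) *v v = c *s v \<longleftrightarrow> lower P v = c *s lower G v"
proof
  assume *: "map_matrix complex_of_real (raise_index G P) *v v = c *s v"
  have "map_matrix complex_of_real G *v (map_matrix complex_of_real (raise_index G P) *v v)
      = map_matrix complex_of_real (transpose P) *v v"
    unfolding map_matrix_mult raise_index_def matrix_mul_assoc invertible_matrix_inv(1)[OF assms(1)] by simp
  then show "lower P v = c *s lower G v"
    unfolding * lower_eq assms(2) by (simp add: vector_scalar_commute)
next
  assume *: "lower P v = c *s lower G v"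
  have "map_matrix complex_of_real (raise_index G P) *v v
      = map_matrix complex_of_real (matrix_inv G) *v lower P v"
    unfolding map_matrix_mult raise_index_def lower_eq ..
  also have "\<dots> = c *s (map_matrix complex_of_real (matrix_inv G ** G) *v v)"
    unfolding * by (simp add: lower_eq assms(2) vector_scalar_commute map_matrix_mult)
  finally show "map_matrix complex_of_real (raise_index G P) *v v = c *s v"
    by (simp add: invertible_matrix_inv(2)[OF assms(1)])
qed

lemma matrix_vector_mult_sum_right:
  fixes A :: "'a::comm_semiring_1^'n^'m"
  shows "A *v (\<Sum>i\<in>S. f i) = (\<Sum>i\<in>S. A *v f i)"
  by (induction S rule: infinite_finite_induct) (auto simp: matrix_vector_right_distrib)

lemma cbil_sum_tensors:
  assumes "\<And>i j. complex_of_real (B $ i $ j) = (\<Sum>\<mu>\<in>M. \<alpha>1 \<mu> $ i * \<beta>1 \<mu> $ j + \<alpha>2 \<mu> $ i * \<beta>2 \<mu> $ j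
      + \<alpha>3 \<mu> $ i * \<beta>3 \<mu> $ j + \<alpha>4 \<mu> $ i * \<beta>4 \<mu> $ j)"
  shows "cbil B y z = (\<Sum>\<mu>\<in>M. form_apply (\<alpha>1 \<mu>) y * form_apply (\<beta>1 \<mu>) z
      + form_apply (\<alpha>2 \<mu>) y * form_apply (\<beta>2 \<mu>) z
      + form_apply (\<alpha>3 \<mu>) y * form_apply (\<beta>3 \<mu>) z + form_apply (\<alpha>4 \<mu>) y * form_apply (\<beta>4 \<mu>) z)"
proof -
  let ?t = "\<lambda>\<mu> i j. (\<alpha>1 \<mu> $ i * \<beta>1 \<mu> $ j) * y $ i * z $ j + (\<alpha>2 \<mu> $ i * \<beta>2 \<mu> $ j) * y $ i * z $ j
      + (\<alpha>3 \<mu> $ i * \<beta>3 \<mu> $ j) * y $ i * z $ j + (\<alpha>4 \<mu> $ i * \<beta>4 \<mu> $ j) * y $ i * z $ j"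
  have tensor: "form_apply \<alpha> y * form_apply \<beta> z
      = (\<Sum>i\<in>UNIV. \<Sum>j\<in>UNIV. (\<alpha> $ i * \<beta> $ j) * y $ i * z $ j)" for \<alpha> \<beta> :: "complex^'a"
    by (simp add: form_apply_def sum_product mult_ac)
  have "cbil B y z = (\<Sum>i\<in>UNIV. \<Sum>j\<in>UNIV. \<Sum>\<mu>\<in>M. ?t \<mu> i j)"
    by (simp add: cbil_def assms sum_distrib_right distrib_right)
  also have "\<dots> = (\<Sum>i\<in>UNIV. \<Sum>\<mu>\<in>M. \<Sum>j\<in>UNIV. ?t \<mu> i j)"
    by (intro sum.cong refl sum.swap)
  also have "\<dots> = (\<Sum>\<mu>\<in>M. \<Sum>i\<in>UNIV. \<Sum>j\<in>UNIV. ?t \<mu> i j)"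
    by (rule sum.swap)
  finally show ?thesis by (simp add: tensor sum.distrib)
qed

lemma cbil_null_sum:
  assumes "\<And>i j. complex_of_real (B $ i $ j)
      = (\<Sum>\<mu>\<in>M. p \<mu> * (a \<mu> $ i * c \<mu> $ j) + q \<mu> * (c \<mu> $ i * a \<mu> $ j))"
  shows "cbil B y z = (\<Sum>\<mu>\<in>M. p \<mu> * (form_apply (a \<mu>) y * form_apply (c \<mu>) z)
      + q \<mu> * (form_apply (c \<mu>) y * form_apply (a \<mu>) z))"
  using cbil_sum_tensors[of B "\<lambda>\<mu>. p \<mu> *s a \<mu>" c "\<lambda>\<mu>. q \<mu> *s c \<mu>" a "\<lambda>_. 0" "\<lambda>_. 0" "\<lambda>_. 0" "\<lambda>_. 0" M y z]
  by (simp add: assms mult.assoc)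

text \<open>An adapted null coframe at one point: \<open>G\<close> is the metric, \<open>P\<close> the 2-form, and each pair consists of \<open>a \<mu>\<close>
  and its conjugate.\<close>

locale null_coframe_at =
  fixes m :: nat and G P :: "real^'n^'n::finite"
    and l :: "nat \<Rightarrow> complex" and a :: "nat \<Rightarrow> complex^'n"
  assumes dim: "CARD('n) = 2 * m"
    and G_sym: "transpose G = G"
    and G_pos: "\<And>v. v \<noteq> 0 \<Longrightarrow> v \<bullet> (G *v v) > 0"
    and G_eq: "\<And>i j. complex_of_real (G $ i $ j) =
        (\<Sum>\<mu>=1..m. a \<mu> $ i * conj_form (a \<mu>) $ j + conj_form (a \<mu>) $ i * a \<mu> $ j)"
    and P_eq: "map_matrix complex_of_real P =
        (\<Sum>\<mu>=1..m. map_matrix ((*) (l \<mu>)) (wedge (a \<mu>) (conj_form (a \<mu>))))"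
    and distinct: "card (eigenvalues (raise_index G P)) = CARD('n)"
begin

text \<open>The metric dual of \<open>a \<mu>\<close>. As the coframe is null, it is dual not to \<open>a \<mu>\<close> but to its conjugate.\<close>

definition e :: "nat \<Rightarrow> complex^'n" where
  "e \<mu> = map_matrix complex_of_real (matrix_inv G) *v a \<mu>"

abbreviation c :: "nat \<Rightarrow> complex^'n" where "c \<mu> \<equiv> conj_form (a \<mu>)"

lemma G_inv: "invertible G"
  using metric_invertible G_pos by blast

lemma conj_e: "conj_form (e \<mu>) = map_matrix complex_of_real (matrix_inv G) *v c \<mu>"
  by (simp add: e_def vec_eq_iff matrix_vector_mult_def)

lemma cbil_G: "cbil G y z = (\<Sum>\<mu>=1..m. form_apply (a \<mu>) y * form_apply (c \<mu>) z
    + form_apply (c \<mu>) y * form_apply (a \<mu>) z)"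
  using cbil_null_sum[where B=G and p="\<lambda>_. 1" and q="\<lambda>_. 1" and a=a and c=c and M="{1..m}"]
  by (simp add: G_eq)

lemma P_nth: "complex_of_real (P $ i $ j)
    = (\<Sum>\<mu>=1..m. l \<mu> * (a \<mu> $ i * c \<mu> $ j) + (- l \<mu>) * (c \<mu> $ i * a \<mu> $ j))"
  using arg_cong[OF P_eq, of "\<lambda>M. M $ i $ j"]
  by (simp add: wedge_def algebra_simps)

lemma cbil_P: "cbil P y z = (\<Sum>\<mu>=1..m. l \<mu> * (form_apply (a \<mu>) y * form_apply (c \<mu>) z)
    + (- l \<mu>) * (form_apply (c \<mu>) y * form_apply (a \<mu>) z))"
  by (rule cbil_null_sum[OF P_nth])

lemma expand: "y = (\<Sum>\<mu>=1..m. form_apply (a \<mu>) y *s conj_form (e \<mu>) + form_apply (c \<mu>) y *s e \<mu>)"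
proof -
  have "lower G y $ j = (\<Sum>\<mu>=1..m. form_apply (a \<mu>) y *s c \<mu> + form_apply (c \<mu>) y *s a \<mu>) $ j" for j
    using cbil_G[of y "axis j 1"] by (simp add: form_apply_axis flip: form_apply_lower)
  then have "map_matrix complex_of_real G *v y = (\<Sum>\<mu>=1..m. form_apply (a \<mu>) y *s c \<mu> + form_apply (c \<mu>) y *s a \<mu>)"
    by (simp add: vec_eq_iff lower_eq G_sym)
  then have "map_matrix complex_of_real (matrix_inv G ** G) *v y
      = map_matrix complex_of_real (matrix_inv G) *v
          (\<Sum>\<mu>=1..m. form_apply (a \<mu>) y *s c \<mu> + form_apply (c \<mu>) y *s a \<mu>)"
    by (simp add: map_matrix_mult[symmetric])
  also have "\<dots> = (\<Sum>\<mu>=1..m. form_apply (a \<mu>) y *s conj_form (e \<mu>) + form_apply (c \<mu>) y *s e \<mu>)"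
    by (simp add: conj_e[unfolded e_def] e_def matrix_vector_right_distrib vector_scalar_commute
        matrix_vector_mult_sum_right)
  finally show ?thesis by (simp add: invertible_matrix_inv(2)[OF G_inv])
qed

lemma dual:
  assumes "\<mu> \<in> {1..m}" "\<nu> \<in> {1..m}"
  shows "form_apply (a \<mu>) (conj_form (e \<nu>)) = (if \<mu> = \<nu> then 1 else 0)"
    and "form_apply (a \<mu>) (e \<nu>) = 0"
    and "form_apply (c \<mu>) (conj_form (e \<nu>)) = 0"
    and "form_apply (c \<mu>) (e \<nu>) = (if \<mu> = \<nu> then 1 else 0)"
  using null_frame_iff[OF dim, of a "\<lambda>\<mu>. conj_form (e \<mu>)" c e] expand assms by blast+

lemma cbil_e:
  assumes "\<nu> \<in> {1..m}"
  shows "cbil G y (e \<nu>) = form_apply (a \<nu>) y" "cbil P y (e \<nu>) = l \<nu> * form_apply (a \<nu>) y"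
    and "cbil G y (conj_form (e \<nu>)) = form_apply (c \<nu>) y"
    and "cbil P y (conj_form (e \<nu>)) = - l \<nu> * form_apply (c \<nu>) y"
    and "cbil G (e \<nu>) y = form_apply (a \<nu>) y" "cbil P (e \<nu>) y = - l \<nu> * form_apply (a \<nu>) y"
  using assms by (simp_all add: cbil_G cbil_P dual if_distrib if_distribR sum.delta sum.delta' sum.distrib sum_negf
      cong: sum.cong_simp if_cong)

text \<open>Evaluated on a frame vector, the eigenvalue equation says that \<open>k\<close> is \<open>\<plusminus>l \<nu>\<close> whenever the corresponding
  component of the eigenvector is not zero.\<close>

lemma eigenvalues_subset: "eigenvalues (raise_index G P) \<subseteq> case_sum l (\<lambda>\<mu>. - l \<mu>) ` ({1..m} <+> {1..m})"
proof
  fix k assume "k \<in> eigenvalues (raise_index G P)"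
  then obtain v where v: "v \<noteq> 0" "lower P v = k *s lower G v"
    unfolding eigenvalues_def using eigenvector_iff[OF G_inv G_sym] by auto
  have eq: "cbil P v z = k * cbil G v z" for z
    using v(2) by (simp flip: form_apply_lower)
  obtain \<nu> where \<nu>: "\<nu> \<in> {1..m}" "form_apply (a \<nu>) v \<noteq> 0 \<or> form_apply (c \<nu>) v \<noteq> 0"
    using expand[of v] v(1) by (metis (no_types, lifting) add.right_neutral sum.neutral vector_smult_lzero)
  have "(k - l \<nu>) * form_apply (a \<nu>) v = 0" "(k + l \<nu>) * form_apply (c \<nu>) v = 0"
    using eq[of "e \<nu>"] eq[of "conj_form (e \<nu>)"] unfolding cbil_e[OF \<nu>(1)] by algebra+
  then have "k = l \<nu> \<or> k = - l \<nu>"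
    using \<nu>(2) by (auto simp: eq_neg_iff_add_eq_0)
  then show "k \<in> case_sum l (\<lambda>\<mu>. - l \<mu>) ` ({1..m} <+> {1..m})"
    using \<nu>(1) by (force simp: image_iff)
qed

text \<open>The \<open>m\<close> pairs \<open>\<plusminus>l \<mu>\<close> have to account for \<open>2m\<close> eigenvalues, so no two of these numbers coincide.\<close>

lemma eigenvalue_sum_nonzero:
  assumes "\<mu> \<in> {1..m}" "\<nu> \<in> {1..m}"
  shows "l \<mu> + l \<nu> \<noteq> 0"
proof
  assume 0: "l \<mu> + l \<nu> = 0"
  let ?I = "{1..m} <+> {1..m}" and ?f = "case_sum l (\<lambda>\<mu>. - l \<mu>)"
  have "finite ?I" "card ?I = CARD('n)" using dim by (auto simp: card_Plus)
  then have "inj_on ?f ?I"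
    using card_mono[OF _ eigenvalues_subset] card_image_le[of ?I ?f] distinct
    by (intro eq_card_imp_inj_on) auto
  moreover have "?f (Inl \<mu>) = ?f (Inr \<nu>)" using 0 by (simp add: eq_neg_iff_add_eq_0)
  ultimately show False
    using inj_onD[OF _ _ InlI[OF assms(1)] InrI[OF assms(2)]] by blast
qed

definition D :: "(complex^'n) set" where "D = {v. \<forall>\<mu>\<in>{1..m}. form_apply (a \<mu>) v = 0}"

lemma D_expand: "v \<in> D \<Longrightarrow> v = (\<Sum>\<mu>=1..m. form_apply (c \<mu>) v *s e \<mu>)"
  using expand[of v] by (simp add: D_def)

lemma e_in_D: "\<nu> \<in> {1..m} \<Longrightarrow> e \<nu> \<in> D"
  by (simp add: D_def dual)

lemma D_isotropic: "v \<in> D \<Longrightarrow> w \<in> D \<Longrightarrow> cbil G v w = 0"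
  by (simp add: cbil_G D_def)

lemma D_subspace: "vec.subspace D"
  by (rule vec.subspaceI) (auto simp: D_def)

lemma D_dim: "vec.dim D = m"
proof (rule vec.dim_unique)
  have inj: "inj_on e {1..m}"
    using dual(4) by (intro inj_onI) (metis zero_neq_one)
  show "e ` {1..m} \<subseteq> D" using e_in_D by blast
  show "D \<subseteq> vec.span (e ` {1..m})"
  proof
    fix v assume "v \<in> D"
    then show "v \<in> vec.span (e ` {1..m})"
      using D_expand[of v] by (metis (no_types, lifting) image_eqI vec.span_base vec.span_scale vec.span_sum)
  qed
  show "vec.independent (e ` {1..m})"
  proof (rule vec.independent_if_scalars_zero)
    fix f x assume 0: "(\<Sum>x\<in>e ` {1..m}. f x *s x) = 0" and "x \<in> e ` {1..m}"
    then obtain \<nu> where \<nu>: "\<nu> \<in> {1..m}" "x = e \<nu>" by blast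
    have "(\<Sum>\<mu>=1..m. f (e \<mu>) *s e \<mu>) = 0"
      using 0 unfolding sum.reindex[OF inj] by (simp add: o_def)
    then have "form_apply (c \<nu>) (\<Sum>\<mu>=1..m. f (e \<mu>) *s e \<mu>) = 0" by simp
    then show "f x = 0" using \<nu>
      by (simp add: form_apply_sum dual if_distrib cong: sum.cong_simp if_cong)
  qed simp
  show "card (e ` {1..m}) = m" using card_image[OF inj] by simp
qed

text \<open>An orthogonal structure \<open>J\<close> for which \<open>P\<close> has type (1,1) commutes with the endomorphism defined by
  \<open>P\<close>, so it preserves its simple eigenspaces and with them \<open>D\<close>.\<close>

lemma D_invariant:
  assumes J2: "J ** J = - mat 1" and JG: "transpose J ** G ** J = G" and JP: "transpose J ** P ** J = P"
    and "v \<in> D"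
  shows "map_matrix complex_of_real J *v v \<in> D"
proof -
  have skew: "transpose J ** B = - (B ** J)" if "transpose J ** B ** J = B" for B
  proof -
    have "B ** J = transpose J ** B ** (J ** J)"
      using that by (simp add: matrix_mul_assoc)
    also have "\<dots> = - (transpose J ** B)"
      unfolding J2 by (simp add: matrix_matrix_mult_def vec_eq_iff mat_def sum_negf if_distrib cong: if_cong)
    finally show ?thesis by simp
  qed
  have swap: "cbil B (map_matrix complex_of_real J *v y) z = - cbil B y (map_matrix complex_of_real J *v z)"
    if "transpose J ** B ** J = B" for B y z
    unfolding cbil_matrix_left cbil_matrix_right skew[OF that] by (simp add: cbil_def sum_negf)
  have "form_apply (a \<nu>) (map_matrix complex_of_real J *v e \<mu>) = 0"
    if "\<mu> \<in> {1..m}" "\<nu> \<in> {1..m}" for \<mu> \<nu>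
  proof -
    let ?y = "map_matrix complex_of_real J *v e \<mu>"
    have "cbil P ?y z = - l \<mu> * cbil G ?y z" for z
      unfolding swap[OF JP] swap[OF JG] using cbil_e[OF that(1)] by simp
    from this[of "e \<nu>"] have "(l \<mu> + l \<nu>) * form_apply (a \<nu>) ?y = 0"
      using that by (simp add: cbil_e algebra_simps)
    then show ?thesis using eigenvalue_sum_nonzero that by simp
  qed
  moreover have "map_matrix complex_of_real J *v v
      = (\<Sum>\<mu>=1..m. form_apply (c \<mu>) v *s (map_matrix complex_of_real J *v e \<mu>))"
    by (subst D_expand[OF \<open>v \<in> D\<close>]) (simp add: matrix_vector_mult_sum_right vector_scalar_commute)
  ultimately show ?thesis
    by (simp add: D_def form_apply_sum)
qed

text \<open>The first equation makes \<open>n \<rho> (e \<nu>)\<close> skew in \<open>\<rho>, \<nu>\<close>, and the second one then multiplies it by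
  \<open>l \<rho> + l \<nu> \<noteq> 0\<close>.\<close>

lemma D_geodesic_algebra:
  fixes n :: "nat \<Rightarrow> complex^'n"
  assumes sym: "\<And>Y Z. Y \<in> D \<Longrightarrow> Z \<in> D \<Longrightarrow>
      (\<Sum>\<mu>=1..m. form_apply (n \<mu>) Y * form_apply (c \<mu>) Z + form_apply (c \<mu>) Y * form_apply (n \<mu>) Z) = 0"
    and skew: "\<And>Y Z. Y \<in> D \<Longrightarrow> Z \<in> D \<Longrightarrow>
      (\<Sum>\<mu>=1..m. l \<mu> * (form_apply (n \<mu>) Y * form_apply (c \<mu>) Z)
        - l \<mu> * (form_apply (c \<mu>) Y * form_apply (n \<mu>) Z)) = 0"
    and "\<rho> \<in> {1..m}" "Y \<in> D"
  shows "form_apply (n \<rho>) Y = 0"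
proof -
  have "form_apply (n \<rho>) (e \<nu>) = 0" if "\<nu> \<in> {1..m}" for \<nu>
  proof -
    have 1: "form_apply (n \<rho>) (e \<nu>) + form_apply (n \<nu>) (e \<rho>) = 0"
      using sym[OF e_in_D e_in_D, OF that \<open>\<rho> \<in> {1..m}\<close>] that assms(3)
      by (simp add: dual sum.distrib if_distrib if_distribR cong: sum.cong_simp if_cong)
    have "l \<rho> * form_apply (n \<rho>) (e \<nu>) - l \<nu> * form_apply (n \<nu>) (e \<rho>) = 0"
      using skew[OF e_in_D e_in_D, OF that \<open>\<rho> \<in> {1..m}\<close>] that assms(3)
      by (simp add: dual sum_subtractf if_distrib if_distribR cong: sum.cong_simp if_cong)
    with 1 have "(l \<rho> + l \<nu>) * form_apply (n \<rho>) (e \<nu>) = 0" by algebra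
    then show ?thesis using eigenvalue_sum_nonzero that assms(3) by simp
  qed
  then show ?thesis
    by (subst D_expand[OF \<open>Y \<in> D\<close>]) (simp add: form_apply_sum)
qed

end

section \<open>Complex structures at a point\<close>

definition cvec :: "real^'n::finite \<Rightarrow> complex^'n" where "cvec v = (\<chi> i. complex_of_real (v $ i))"

lemma cvec_nth [simp]: "cvec v $ i = complex_of_real (v $ i)"
  by (simp add: cvec_def)

lemma map_matrix_cvec: "map_matrix complex_of_real A *v cvec v = cvec (A *v v)"
  by (simp add: vec_eq_iff matrix_vector_mult_def)

lemma map_matrix_eqI:
  assumes "\<And>v. map_matrix complex_of_real A *v v = map_matrix complex_of_real B *v v"
  shows "A = B"
proof -
  have "(map_matrix complex_of_real C *v axis j 1) $ i = complex_of_real (C $ i $ j)" for C :: "real^'a^'b" and i j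
    by (simp add: matrix_vector_mult_def sum_mult_axis)
  then show ?thesis using assms by (metis of_real_eq_iff vec_eq_iff)
qed

lemma map_matrix_uminus: "map_matrix complex_of_real (- A) *v v = - (map_matrix complex_of_real A *v v)"
  by (simp add: vec_eq_iff matrix_vector_mult_def sum_negf)

lemma cbil_eqI: "(\<And>y z. cbil A y z = cbil B y z) \<Longrightarrow> A = B"
  by (metis cbil_axis of_real_eq_iff vec_eq_iff)

lemma orthogonal_structure_iff:
  "orthogonal_structure U g J \<longleftrightarrow> (\<forall>x\<in>U. transpose (J x) ** g x ** J x = g x)"
proof -
  have "(J x *v v) \<bullet> (g x *v (J x *v w)) = v \<bullet> ((transpose (J x) ** g x ** J x) *v w)" for x v w
    by (metis (no_types, lifting) dot_lmul_matrix matrix_vector_mul_assoc transpose_matrix_vector transpose_transpose)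
  then show ?thesis
    unfolding orthogonal_structure_def by (simp add: matrix_eq vector_eq_ldot) (metis vector_eq_ldot)
qed

lemma matrix_vector_mult_uminus: "(- A) *v v = - (A *v (v :: 'a::comm_ring_1^'n))"
  by (simp add: vec_eq_iff matrix_vector_mult_def sum_negf)

text \<open>The vectors \<open>v - i A v\<close> with \<open>v\<close> real lie in \<open>T10 A\<close>, and the real part of the equation that puts
  them into \<open>T10 B\<close> is \<open>B v = A v\<close>.\<close>

lemma T10_determines:
  assumes "A ** A = - mat 1" "T10 A \<subseteq> T10 B"
  shows "A = B"
proof -
  have "A *v v = B *v v" for v
  proof -
    let ?w = "cvec v + (- \<i>) *s cvec (A *v v)"
    have *: "map_matrix complex_of_real C *v ?w = cvec (C *v v) + (- \<i>) *s cvec (C *v (A *v v))" for C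
      by (simp only: matrix_vector_right_distrib vector_scalar_commute map_matrix_cvec)
    have "A *v (A *v v) = - v"
      using assms(1) by (simp add: matrix_vector_mul_assoc matrix_vector_mult_uminus)
    then have "?w \<in> T10 A"
      unfolding T10_def mem_Collect_eq * by (simp add: vec_eq_iff algebra_simps)
    then have "?w \<in> T10 B" using assms(2) by blast
    then have "cvec (B *v v) + (- \<i>) *s cvec (B *v (A *v v)) = \<i> *s ?w"
      unfolding T10_def mem_Collect_eq * .
    then show ?thesis by (simp add: vec_eq_iff complex_eq_iff)
  qed
  then show ?thesis by (simp add: matrix_eq)
qed

context null_coframe_at
begin

lemma frame_eqI:
  assumes "\<And>\<mu>. \<mu> \<in> {1..m} \<Longrightarrow> form_apply (a \<mu>) v = form_apply (a \<mu>) w"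
    and "\<And>\<mu>. \<mu> \<in> {1..m} \<Longrightarrow> form_apply (c \<mu>) v = form_apply (c \<mu>) w"
  shows "v = w"
  by (subst expand[of v], subst expand[of w]) (use assms in \<open>auto intro!: sum.cong\<close>)

text \<open>The real matrix of the operator that acts on \<open>D\<close> as \<open>i\<close> and on its conjugate as \<open>-i\<close>, that is, of
  the sum of the tensors \<open>i e \<mu> \<otimes> c \<mu>\<close> and of their conjugates.\<close>

definition I_mat :: "real^'n^'n" where
  "I_mat = (\<chi> i j. - 2 * (\<Sum>\<mu>=1..m. Im (e \<mu> $ i * c \<mu> $ j)))"

lemma I_mat_mult:
  "map_matrix complex_of_real I_mat *v v
    = (\<Sum>\<mu>=1..m. (\<i> * form_apply (c \<mu>) v) *s e \<mu> + (- \<i> * form_apply (a \<mu>) v) *s conj_form (e \<mu>))"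
proof -
  have im: "complex_of_real (- 2 * Im z) = \<i> * z - \<i> * cnj z" for z
    by (simp add: complex_eq_iff)
  have "complex_of_real (I_mat $ i $ j)
      = (\<Sum>\<mu>=1..m. \<i> * (e \<mu> $ i * c \<mu> $ j) - \<i> * (conj_form (e \<mu>) $ i * a \<mu> $ j))" for i j
    unfolding I_mat_def vec_lambda_beta sum_distrib_left of_real_sum im by simp
  then have "(map_matrix complex_of_real I_mat *v v) $ i
      = (\<Sum>j\<in>UNIV. \<Sum>\<mu>=1..m. \<i> * (e \<mu> $ i * (c \<mu> $ j * v $ j)) - \<i> * (conj_form (e \<mu>) $ i * (a \<mu> $ j * v $ j)))" for i
    by (simp add: matrix_vector_mult_def sum_distrib_right left_diff_distrib mult.assoc)
  also have "\<dots> i = (\<Sum>\<mu>=1..m. \<Sum>j\<in>UNIV. \<i> * (e \<mu> $ i * (c \<mu> $ j * v $ j)) - \<i> * (conj_form (e \<mu>) $ i * (a \<mu> $ j * v $ j)))" for i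
    by (rule sum.swap)
  finally show ?thesis
    by (simp add: vec_eq_iff form_apply_def sum_subtractf sum_negf sum.distrib sum_distrib_left mult_ac)
qed

lemma form_apply_I:
  assumes "\<nu> \<in> {1..m}"
  shows "form_apply (a \<nu>) (map_matrix complex_of_real I_mat *v v) = - \<i> * form_apply (a \<nu>) v"
    and "form_apply (c \<nu>) (map_matrix complex_of_real I_mat *v v) = \<i> * form_apply (c \<nu>) v"
  using assms unfolding I_mat_mult
  by (simp_all add: form_apply_sum dual if_distrib sum_negf sum_subtractf cong: sum.cong_simp if_cong)

lemma T10_I: "T10 I_mat = D"
proof -
  have "v \<in> T10 I_mat \<longleftrightarrow> v \<in> D" for v
  proof
    assume "v \<in> T10 I_mat"
    then have "map_matrix complex_of_real I_mat *v v = \<i> *s v" by (simp add: T10_def)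
    then have "- \<i> * form_apply (a \<nu>) v = \<i> * form_apply (a \<nu>) v" if "\<nu> \<in> {1..m}" for \<nu>
      using form_apply_I(1)[OF that, of v] by simp
    then show "v \<in> D" by (simp add: D_def)
  next
    assume "v \<in> D"
    then show "v \<in> T10 I_mat" unfolding T10_def mem_Collect_eq
      by (intro frame_eqI) (simp_all only: form_apply_I form_apply_linear_simps, simp_all add: D_def)
  qed
  then show ?thesis by blast
qed

lemma I_square: "I_mat ** I_mat = - mat 1"
proof (rule map_matrix_eqI)
  fix v
  have "map_matrix complex_of_real (I_mat ** I_mat) *v v = (-1) *s v"
    unfolding map_matrix_mult[symmetric]
    by (intro frame_eqI) (simp_all only: form_apply_I form_apply_linear_simps, simp_all)
  then show "map_matrix complex_of_real (I_mat ** I_mat) *v v = map_matrix complex_of_real (- mat 1) *v v"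
    by (simp add: map_matrix_uminus)
qed

lemma I_orthogonal: "transpose I_mat ** G ** I_mat = G"
proof (rule cbil_eqI)
  fix y z
  let ?I = "\<lambda>v. map_matrix complex_of_real I_mat *v v"
  have i: "- \<i> * p * (\<i> * q) = p * q" "\<i> * p * (- \<i> * q) = p * q" for p q
    by (simp_all add: complex_eq_iff algebra_simps)
  have "cbil (transpose I_mat ** G ** I_mat) y z = cbil G (?I y) (?I z)"
    by (simp only: cbil_matrix_left cbil_matrix_right matrix_mul_assoc)
  also have "\<dots> = cbil G y z"
    unfolding cbil_G by (intro sum.cong refl) (simp only: form_apply_I i)
  finally show "cbil (transpose I_mat ** G ** I_mat) y z = cbil G y z" .
qed

end

section \<open>The Levi-Civita connection on 1-forms\<close>

lemma cov_deriv_axis: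
  "cov_deriv g B x (axis k 1) $ i $ j = pd k (\<lambda>y. B y $ i $ j) x
      - (\<Sum>l\<in>UNIV. christoffel g x l k i * B x $ l $ j)
      - (\<Sum>l\<in>UNIV. christoffel g x l k j * B x $ i $ l)"
  unfolding cov_deriv_def vec_lambda_beta mult.commute[of "axis k 1 $ _"] sum_mult_axis ..

lemma pd_metric_sym:
  assumes "open U" "x \<in> U" "\<And>y. y \<in> U \<Longrightarrow> transpose (g y) = g y"
  shows "pd k (\<lambda>y. g y $ i $ j) x = pd k (\<lambda>y. g y $ j $ i) x"
proof (rule pd_cong_open[OF assms(1,2)])
  fix y assume "y \<in> U"
  show "g y $ i $ j = g y $ j $ i"
    using arg_cong[OF assms(3)[OF \<open>y \<in> U\<close>], of "\<lambda>M. M $ j $ i"] by (simp add: transpose_def)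
qed

lemma christoffel_sym:
  assumes "open U" "x \<in> U" "\<And>y. y \<in> U \<Longrightarrow> transpose (g y) = g y"
  shows "christoffel g x l i j = christoffel g x l j i"
proof -
  have "pd k (\<lambda>y. g y $ i $ j) x = pd k (\<lambda>y. g y $ j $ i) x" for k
    by (rule pd_metric_sym[OF assms])
  then show ?thesis unfolding christoffel_def by (simp add: add.commute)
qed

text \<open>The Christoffel symbols of the first kind.\<close>

lemma christoffel_lower:
  assumes "transpose (g x) = g x" "invertible (g x)"
  shows "(\<Sum>l\<in>UNIV. christoffel g x l i j * g x $ l $ r)
    = (pd i (\<lambda>y. g y $ j $ r) x + pd j (\<lambda>y. g y $ i $ r) x - pd r (\<lambda>y. g y $ i $ j) x) / 2"
proof -
  let ?w = "\<lambda>k. pd i (\<lambda>y. g y $ j $ k) x + pd j (\<lambda>y. g y $ i $ k) x - pd k (\<lambda>y. g y $ i $ j) x"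
  have sym: "g x $ l $ r = g x $ r $ l" for l
    using arg_cong[OF assms(1), of "\<lambda>M. M $ r $ l"] by (simp add: transpose_def)
  have "(\<Sum>l\<in>UNIV. g x $ r $ l * matrix_inv (g x) $ l $ k) = (if r = k then 1 else 0)" for k
    using arg_cong[OF invertible_matrix_inv(1)[OF assms(2)], of "\<lambda>M. M $ r $ k"]
    by (simp add: matrix_matrix_mult_def mat_def)
  then have "(\<Sum>k\<in>UNIV. (\<Sum>l\<in>UNIV. g x $ r $ l * matrix_inv (g x) $ l $ k) * ?w k)
      = (\<Sum>k\<in>UNIV. if k = r then ?w k else 0)"
    by (intro sum.cong) auto
  then have "?w r = (\<Sum>k\<in>UNIV. (\<Sum>l\<in>UNIV. g x $ r $ l * matrix_inv (g x) $ l $ k) * ?w k)"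
    by simp
  also have "\<dots> = (\<Sum>l\<in>UNIV. \<Sum>k\<in>UNIV. g x $ r $ l * matrix_inv (g x) $ l $ k * ?w k)"
    unfolding sum_distrib_right by (rule sum.swap)
  also have "\<dots> = (\<Sum>l\<in>UNIV. (\<Sum>k\<in>UNIV. matrix_inv (g x) $ l $ k * ?w k) * g x $ l $ r)"
    unfolding sum_distrib_right sym by (intro sum.cong refl) (simp only: mult_ac)
  finally show ?thesis
    unfolding christoffel_def times_divide_eq_left sum_divide_distrib[symmetric] by simp
qed

lemma cov_deriv_metric:
  assumes "open U" "x \<in> U" "\<And>y. y \<in> U \<Longrightarrow> transpose (g y) = g y" "invertible (g x)"
  shows "cov_deriv g g x (axis k 1) = 0"
proof -
  note low = christoffel_lower[where g=g and x=x, OF assms(3)[OF assms(2)] assms(4)]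
  have sym: "g x $ i $ l = g x $ l $ i" for i l
    using arg_cong[OF assms(3)[OF assms(2)], of "\<lambda>M. M $ l $ i"] by (simp add: transpose_def)
  have pd_sym: "pd k (\<lambda>y. g y $ i $ j) x = pd k (\<lambda>y. g y $ j $ i) x" for k i j
    by (rule pd_metric_sym[OF assms(1-3)])
  have "cov_deriv g g x (axis k 1) $ i $ j = 0" for i j
    unfolding cov_deriv_axis sym[of i] low
    using pd_sym[of k i j] pd_sym[of i k j] pd_sym[of j k i] by (simp add: field_simps)
  then show ?thesis by (simp add: vec_eq_iff)
qed

text \<open>The covariant derivative of a complex 1-form in the direction of the coordinate vector \<open>k\<close>.\<close>

definition cov_form :: "(real^'n::finite \<Rightarrow> real^'n^'n) \<Rightarrow> (real^'n \<Rightarrow> complex^'n) \<Rightarrow> real^'n \<Rightarrow> 'n \<Rightarrow> complex^'n" where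
  "cov_form g \<alpha> x k = (\<chi> i. pd k \<alpha> x $ i - (\<Sum>l\<in>UNIV. complex_of_real (christoffel g x l k i) * \<alpha> x $ l))"

lemma pd_nth: "f differentiable (at x) \<Longrightarrow> pd k (\<lambda>y. f y $ i) x = pd k f x $ i"
  by (rule pd_linear[OF bounded_linear_vec_nth])

lemma differentiable_nth: "f differentiable (at x) \<Longrightarrow> (\<lambda>y. f y $ i) differentiable (at x)"
  by (rule differentiable_linear[OF bounded_linear_vec_nth])

lemma pd_cnj: "f differentiable (at x) \<Longrightarrow> pd k (\<lambda>y. cnj (f y)) x = cnj (pd k f x)"
  by (rule pd_linear[OF bounded_linear_cnj])

text \<open>Product rule for the covariant derivative of \<open>\<Sum> p \<mu> a \<mu> \<otimes> conj (a \<mu>) + q \<mu> conj (a \<mu>) \<otimes> a \<mu>\<close>. On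
  vectors annihilated by all \<open>a \<mu>\<close> only the terms survive in which the derivative falls on \<open>a \<mu>\<close>;
  in particular the derivatives of the coefficients drop out.\<close>

lemma cov_deriv_null_sum:
  fixes a :: "'k \<Rightarrow> real^'n::finite \<Rightarrow> complex^'n"
  assumes "open V" "x \<in> V"
    and B: "\<And>y i j. y \<in> V \<Longrightarrow> complex_of_real (B y $ i $ j)
      = (\<Sum>\<mu>\<in>M. p \<mu> y * (a \<mu> y $ i * cnj (a \<mu> y $ j)) + q \<mu> y * (cnj (a \<mu> y $ i) * a \<mu> y $ j))"
    and dB: "B differentiable (at x)"
    and da: "\<And>\<mu>. \<mu> \<in> M \<Longrightarrow> a \<mu> differentiable (at x)"
    and dp: "\<And>\<mu>. \<mu> \<in> M \<Longrightarrow> p \<mu> differentiable (at x)"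
    and dq: "\<And>\<mu>. \<mu> \<in> M \<Longrightarrow> q \<mu> differentiable (at x)"
    and Y: "\<And>\<mu>. \<mu> \<in> M \<Longrightarrow> form_apply (a \<mu> x) Y = 0"
    and Z: "\<And>\<mu>. \<mu> \<in> M \<Longrightarrow> form_apply (a \<mu> x) Z = 0"
  shows "cbil (cov_deriv g B x (axis k 1)) Y Z = (\<Sum>\<mu>\<in>M.
      p \<mu> x * (form_apply (cov_form g (a \<mu>) x k) Y * form_apply (conj_form (a \<mu> x)) Z)
      + q \<mu> x * (form_apply (conj_form (a \<mu> x)) Y * form_apply (cov_form g (a \<mu>) x k) Z))"
proof -
  let ?\<Gamma> = "\<lambda>i l. complex_of_real (christoffel g x l k i)"
  let ?A = "\<lambda>\<mu> i. \<Sum>l\<in>UNIV. ?\<Gamma> i l * a \<mu> x $ l"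
  let ?d = "\<lambda>\<mu>. pd k (a \<mu>) x"
  let ?N = "\<lambda>\<mu>. cov_form g (a \<mu>) x k"
  have N: "?N \<mu> $ i = ?d \<mu> $ i - ?A \<mu> i" for \<mu> i
    by (simp add: cov_form_def)
  note dmult = differentiable_bilinear[OF bounded_bilinear_mult]
  note dcnj = differentiable_linear[OF bounded_linear_cnj]
  have dB': "complex_of_real (pd k (\<lambda>y. B y $ i $ j) x) = (\<Sum>\<mu>\<in>M.
      pd k (p \<mu>) x * (a \<mu> x $ i * cnj (a \<mu> x $ j))
      + p \<mu> x * (?d \<mu> $ i * cnj (a \<mu> x $ j) + a \<mu> x $ i * cnj (?d \<mu> $ j))
      + pd k (q \<mu>) x * (cnj (a \<mu> x $ i) * a \<mu> x $ j)
      + q \<mu> x * (cnj (?d \<mu> $ i) * a \<mu> x $ j + cnj (a \<mu> x $ i) * ?d \<mu> $ j))" for i j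
  proof -
    have "complex_of_real (pd k (\<lambda>y. B y $ i $ j) x) = pd k (\<lambda>y. complex_of_real (B y $ i $ j)) x"
      by (rule pd_linear[OF bounded_linear_of_real, symmetric]) (intro differentiable_nth dB)
    also have "\<dots> = pd k (\<lambda>y. \<Sum>\<mu>\<in>M. p \<mu> y * (a \<mu> y $ i * cnj (a \<mu> y $ j))
        + q \<mu> y * (cnj (a \<mu> y $ i) * a \<mu> y $ j)) x"
      by (rule pd_cong_open[OF assms(1,2) B])
    also have "\<dots> = (\<Sum>\<mu>\<in>M. pd k (\<lambda>y. p \<mu> y * (a \<mu> y $ i * cnj (a \<mu> y $ j))
        + q \<mu> y * (cnj (a \<mu> y $ i) * a \<mu> y $ j)) x)"
      by (rule pd_sum) (intro differentiable_add dmult dcnj differentiable_nth da dp dq; assumption)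
    also have "\<dots> = (\<Sum>\<mu>\<in>M.
      pd k (p \<mu>) x * (a \<mu> x $ i * cnj (a \<mu> x $ j))
      + p \<mu> x * (?d \<mu> $ i * cnj (a \<mu> x $ j) + a \<mu> x $ i * cnj (?d \<mu> $ j))
      + pd k (q \<mu>) x * (cnj (a \<mu> x $ i) * a \<mu> x $ j)
      + q \<mu> x * (cnj (?d \<mu> $ i) * a \<mu> x $ j + cnj (a \<mu> x $ i) * ?d \<mu> $ j))"
    proof (rule sum.cong[OF refl])
      fix \<mu> assume \<mu>: "\<mu> \<in> M"
      note [simp] = da[OF \<mu>] dp[OF \<mu>] dq[OF \<mu>]
      show "pd k (\<lambda>y. p \<mu> y * (a \<mu> y $ i * cnj (a \<mu> y $ j)) + q \<mu> y * (cnj (a \<mu> y $ i) * a \<mu> y $ j)) x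
        = pd k (p \<mu>) x * (a \<mu> x $ i * cnj (a \<mu> x $ j))
          + p \<mu> x * (?d \<mu> $ i * cnj (a \<mu> x $ j) + a \<mu> x $ i * cnj (?d \<mu> $ j))
          + pd k (q \<mu>) x * (cnj (a \<mu> x $ i) * a \<mu> x $ j)
          + q \<mu> x * (cnj (?d \<mu> $ i) * a \<mu> x $ j + cnj (a \<mu> x $ i) * ?d \<mu> $ j)"
        by (simp add: pd_add pd_mult dmult dcnj differentiable_nth pd_cnj pd_nth algebra_simps)
    qed
    finally show ?thesis .
  qed
  have \<Gamma>1: "complex_of_real (\<Sum>l\<in>UNIV. christoffel g x l k i * B x $ l $ j)
      = (\<Sum>\<mu>\<in>M. p \<mu> x * (?A \<mu> i * cnj (a \<mu> x $ j)) + q \<mu> x * (cnj (?A \<mu> i) * a \<mu> x $ j))" for i j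
  proof -
    have "complex_of_real (\<Sum>l\<in>UNIV. christoffel g x l k i * B x $ l $ j)
      = (\<Sum>l\<in>UNIV. \<Sum>\<mu>\<in>M. p \<mu> x * (?\<Gamma> i l * a \<mu> x $ l * cnj (a \<mu> x $ j))
        + q \<mu> x * (cnj (?\<Gamma> i l * a \<mu> x $ l) * a \<mu> x $ j))"
      unfolding of_real_sum of_real_mult B[OF assms(2)] sum_distrib_left
      by (intro sum.cong refl) (simp add: algebra_simps)
    also have "\<dots> = (\<Sum>\<mu>\<in>M. \<Sum>l\<in>UNIV. p \<mu> x * (?\<Gamma> i l * a \<mu> x $ l * cnj (a \<mu> x $ j))
        + q \<mu> x * (cnj (?\<Gamma> i l * a \<mu> x $ l) * a \<mu> x $ j))"
      by (rule sum.swap)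
    finally show ?thesis
      by (simp only: sum.distrib sum_distrib_left[symmetric] sum_distrib_right[symmetric] cnj_sum[symmetric])
  qed
  have \<Gamma>2: "complex_of_real (\<Sum>l\<in>UNIV. christoffel g x l k j * B x $ i $ l)
      = (\<Sum>\<mu>\<in>M. p \<mu> x * (a \<mu> x $ i * cnj (?A \<mu> j)) + q \<mu> x * (cnj (a \<mu> x $ i) * ?A \<mu> j))" for i j
  proof -
    have "complex_of_real (\<Sum>l\<in>UNIV. christoffel g x l k j * B x $ i $ l)
      = (\<Sum>l\<in>UNIV. \<Sum>\<mu>\<in>M. p \<mu> x * (a \<mu> x $ i * cnj (?\<Gamma> j l * a \<mu> x $ l))
        + q \<mu> x * (cnj (a \<mu> x $ i) * (?\<Gamma> j l * a \<mu> x $ l)))"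
      unfolding of_real_sum of_real_mult B[OF assms(2)] sum_distrib_left
      by (intro sum.cong refl) (simp add: algebra_simps)
    also have "\<dots> = (\<Sum>\<mu>\<in>M. \<Sum>l\<in>UNIV. p \<mu> x * (a \<mu> x $ i * cnj (?\<Gamma> j l * a \<mu> x $ l))
        + q \<mu> x * (cnj (a \<mu> x $ i) * (?\<Gamma> j l * a \<mu> x $ l)))"
      by (rule sum.swap)
    finally show ?thesis
      by (simp only: sum.distrib sum_distrib_left[symmetric] sum_distrib_right[symmetric] cnj_sum[symmetric])
  qed
  have "complex_of_real (cov_deriv g B x (axis k 1) $ i $ j) = (\<Sum>\<mu>\<in>M.
      (p \<mu> x *s ?N \<mu>) $ i * conj_form (a \<mu> x) $ j + (q \<mu> x *s conj_form (a \<mu> x)) $ i * ?N \<mu> $ j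
      + a \<mu> x $ i * (p \<mu> x *s conj_form (?N \<mu>) + pd k (p \<mu>) x *s conj_form (a \<mu> x)) $ j
      + (q \<mu> x *s conj_form (?N \<mu>) + pd k (q \<mu>) x *s conj_form (a \<mu> x)) $ i * a \<mu> x $ j)" for i j
    unfolding cov_deriv_axis of_real_diff dB' \<Gamma>1 \<Gamma>2 sum_subtractf[symmetric]
    by (intro sum.cong refl) (simp add: N algebra_simps del: cnj_sum)
  from cbil_sum_tensors[where B="cov_deriv g B x (axis k 1)", OF this, of Y Z] show ?thesis
    using Y Z by (simp add: mult.assoc)
qed

section \<open>Integrability\<close>

lemma lower_nth: "lower B v $ k = form_apply (cvec (B *v axis k 1)) v"
  by (simp add: lower_def form_apply_def matrix_vector_mult_def sum_mult_axis)

lemma sum_lower: "(\<Sum>k\<in>UNIV. X $ k * lower B v $ k) = cbil B v X"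
  by (simp add: form_apply_def mult.commute flip: form_apply_lower)

text \<open>In the equation for a Hamiltonian 2-form every term on the right-hand side contains \<open>g\<close> or \<open>g J\<close>
  paired with the direction of differentiation, so it vanishes on isotropic \<open>J\<close>-invariant subspaces.\<close>

lemma hamiltonian_rhs_vanishes:
  assumes "invertible G"
    and T: "\<And>k. T k = (1/2) *\<^sub>R (wedge s (J_form G J (flat G (axis k 1))) - wedge t (flat G (axis k 1)))"
    and "cbil G Y X = 0" "cbil G Z X = 0"
    and "cbil G Y (map_matrix complex_of_real J *v X) = 0" "cbil G Z (map_matrix complex_of_real J *v X) = 0"
  shows "(\<Sum>k\<in>UNIV. X $ k * cbil (T k) Y Z) = 0"
proof -
  have h: "J_form G J (flat G (axis k 1)) = (G ** J) *v axis k 1" for k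
    by (simp add: J_form_def flat_def sharp_def matrix_vector_mul_assoc matrix_mul_assoc[symmetric]
        invertible_matrix_inv(2)[OF assms(1)])
  let ?h = "\<lambda>k. cvec ((G ** J) *v axis k 1)" and ?f = "\<lambda>k. cvec (G *v axis k 1)"
  have "complex_of_real (T k $ i $ j) = (\<Sum>_\<in>{()}. ((1/2) *s cvec s) $ i * ?h k $ j
      + ?h k $ i * ((-1/2) *s cvec s) $ j
      + ((-1/2) *s cvec t) $ i * ?f k $ j + ?f k $ i * ((1/2) *s cvec t) $ j)" for k i j
    unfolding T h by (simp add: flat_def wedge_def algebra_simps)
  from cbil_sum_tensors[where B="T _", OF this, of _ Y Z]
  have "cbil (T k) Y Z = (1/2 * form_apply (cvec s) Y) * lower (G ** J) Z $ k
      + (-1/2 * form_apply (cvec s) Z) * lower (G ** J) Y $ k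
      + (-1/2 * form_apply (cvec t) Y) * lower G Z $ k + (1/2 * form_apply (cvec t) Z) * lower G Y $ k" for k
    by (simp add: lower_nth mult.commute)
  then have "(\<Sum>k\<in>UNIV. X $ k * cbil (T k) Y Z)
      = (\<Sum>k\<in>UNIV. (1/2 * form_apply (cvec s) Y) * (X $ k * lower (G ** J) Z $ k)
      + (-1/2 * form_apply (cvec s) Z) * (X $ k * lower (G ** J) Y $ k)
      + (-1/2 * form_apply (cvec t) Y) * (X $ k * lower G Z $ k)
      + (1/2 * form_apply (cvec t) Z) * (X $ k * lower G Y $ k))"
    by (intro sum.cong refl) (simp only: algebra_simps)
  also have "\<dots> = 0"
    unfolding sum.distrib sum_distrib_left[symmetric] sum_lower
    by (simp add: assms(3-6) flip: cbil_matrix_right)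
  finally show ?thesis .
qed

lemma sum_contract:
  "(\<Sum>k\<in>UNIV. X $ k * (\<Sum>\<mu>\<in>M. p \<mu> * (form_apply (N \<mu> k) Y * c \<mu>) + q \<mu> * (d \<mu> * form_apply (N \<mu> k) Z)))
    = (\<Sum>\<mu>\<in>M. p \<mu> * (form_apply (\<Sum>k\<in>UNIV. X $ k *s N \<mu> k) Y * c \<mu>)
      + q \<mu> * (d \<mu> * form_apply (\<Sum>k\<in>UNIV. X $ k *s N \<mu> k) Z))"
proof -
  have "(\<Sum>k\<in>UNIV. X $ k * (\<Sum>\<mu>\<in>M. p \<mu> * (form_apply (N \<mu> k) Y * c \<mu>) + q \<mu> * (d \<mu> * form_apply (N \<mu> k) Z)))
    = (\<Sum>k\<in>UNIV. \<Sum>\<mu>\<in>M. p \<mu> * (X $ k * form_apply (N \<mu> k) Y * c \<mu>) + q \<mu> * (d \<mu> * (X $ k * form_apply (N \<mu> k) Z)))"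
    by (simp add: sum_distrib_left algebra_simps)
  also have "\<dots> = (\<Sum>\<mu>\<in>M. \<Sum>k\<in>UNIV. p \<mu> * (X $ k * form_apply (N \<mu> k) Y * c \<mu>) + q \<mu> * (d \<mu> * (X $ k * form_apply (N \<mu> k) Z)))"
    by (rule sum.swap)
  finally show ?thesis
    by (simp add: form_apply_sum_left sum.distrib sum_distrib_left[symmetric] sum_distrib_right[symmetric])
qed

text \<open>A Hamiltonian 2-form on \<open>U\<close> with an adapted coframe on \<open>V\<close>. The distribution studied here is the one
  annihilated by all the \<open>\<theta> \<mu>\<close>; the other choices are reduced to it by interchanging conjugate forms.\<close>

locale hamiltonian_null_coframe =
  fixes U V :: "(real^'n::finite) set" and m :: nat
    and g J \<omega> \<psi> :: "real^'n \<Rightarrow> real^'n^'n"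
    and lam :: "nat \<Rightarrow> real^'n \<Rightarrow> complex" and \<theta> :: "nat \<Rightarrow> real^'n \<Rightarrow> complex^'n"
  assumes dim: "CARD('n) = 2 * m"
    and kaehler: "kaehler U g J \<omega>"
    and hamiltonian: "hamiltonian_2form U g J \<omega> \<psi>"
    and distinct: "has_distinct_eigenvalues U g \<psi>"
    and open_V: "open V" and VU: "V \<subseteq> U"
    and coframe: "adapted_null_coframe V m g \<psi> lam \<theta>"
begin

definition null_dist :: "real^'n \<Rightarrow> (complex^'n) set" where
  "null_dist x = {v. \<forall>\<mu>\<in>{1..m}. form_apply (\<theta> \<mu> x) v = 0}"

definition E :: "nat \<Rightarrow> real^'n \<Rightarrow> complex^'n" where
  "E \<mu> x = map_matrix complex_of_real (matrix_inv (g x)) *v \<theta> \<mu> x"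

lemma metric:
  assumes "x \<in> V"
  shows "transpose (g x) = g x" "v \<noteq> 0 \<Longrightarrow> v \<bullet> (g x *v v) > 0" "invertible (g x)"
  using assms VU kaehler metric_invertible[of "g x"]
  by (auto simp: kaehler_def riemannian_metric_def subset_iff)

lemma coframe_eqs:
  assumes "x \<in> V"
  shows "complex_of_real (g x $ i $ j) =
      (\<Sum>\<mu>=1..m. \<theta> \<mu> x $ i * conj_form (\<theta> \<mu> x) $ j + conj_form (\<theta> \<mu> x) $ i * \<theta> \<mu> x $ j)"
    and "map_matrix complex_of_real (\<psi> x) =
      (\<Sum>\<mu>=1..m. map_matrix ((*) (lam \<mu> x)) (wedge (\<theta> \<mu> x) (conj_form (\<theta> \<mu> x))))"
  using coframe assms unfolding adapted_null_coframe_def by blast+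

lemma at: "x \<in> V \<Longrightarrow> null_coframe_at m (g x) (\<psi> x) (\<lambda>\<mu>. lam \<mu> x) (\<lambda>\<mu>. \<theta> \<mu> x)"
  using dim metric coframe_eqs distinct VU
  by unfold_locales (auto simp: has_distinct_eigenvalues_def)

lemma null_dist_at: "x \<in> V \<Longrightarrow> null_coframe_at.D m (\<lambda>\<mu>. \<theta> \<mu> x) = null_dist x"
  by (simp add: null_coframe_at.D_def[OF at] null_dist_def)

lemma E_at: "x \<in> V \<Longrightarrow> null_coframe_at.e (g x) (\<lambda>\<mu>. \<theta> \<mu> x) \<mu> = E \<mu> x"
  by (simp add: null_coframe_at.e_def[OF at] E_def)

lemma smooth:
  shows "smooth_on V g" "smooth_on V \<psi>" "\<mu> \<in> {1..m} \<Longrightarrow> smooth_on V (\<theta> \<mu>)"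
  using kaehler hamiltonian coframe VU
  by (auto simp: kaehler_def riemannian_metric_def hamiltonian_2form_def adapted_null_coframe_def
      intro: smooth_on_subset)

lemma smooth_E:
  assumes "\<mu> \<in> {1..m}"
  shows "smooth_on V (E \<mu>)"
proof (rule smooth_on_vec[OF open_V])
  fix i
  have "smooth_on V (\<lambda>x. \<Sum>j\<in>UNIV. complex_of_real (matrix_inv (g x) $ i $ j) * \<theta> \<mu> x $ j)"
    by (intro smooth_on_sum smooth_on_mult smooth_on_linear[OF _ bounded_linear_of_real] smooth_on_nth
        smooth_on_matrix_inv open_V smooth metric assms)
  then show "smooth_on V (\<lambda>x. E \<mu> x $ i)"
    by (simp add: E_def matrix_vector_mult_def)
qed

text \<open>The coefficients are values of \<open>\<psi>\<close> on the dual frame, which makes them smooth.\<close>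

lemma differentiable_lam:
  assumes "\<mu> \<in> {1..m}" "x \<in> V"
  shows "lam \<mu> differentiable (at x)"
proof -
  have "lam \<mu> y = (\<Sum>i\<in>UNIV. \<Sum>j\<in>UNIV. complex_of_real (\<psi> y $ i $ j) * cnj (E \<mu> y $ i) * E \<mu> y $ j)"
    if "y \<in> V" for y
  proof -
    interpret null_coframe_at m "g y" "\<psi> y" "\<lambda>\<mu>. lam \<mu> y" "\<lambda>\<mu>. \<theta> \<mu> y" by (rule at[OF that])
    have "cbil (\<psi> y) (conj_form (e \<mu>)) (e \<mu>) = lam \<mu> y"
      using cbil_e(2)[OF assms(1)] dual(1)[OF assms(1,1)] by simp
    then show ?thesis by (simp add: cbil_def E_at[OF that])
  qed
  moreover have "smooth_on V (\<lambda>y. \<Sum>i\<in>UNIV. \<Sum>j\<in>UNIV. complex_of_real (\<psi> y $ i $ j) * cnj (E \<mu> y $ i) * E \<mu> y $ j)"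
    by (intro smooth_on_sum smooth_on_mult smooth_on_linear[OF _ bounded_linear_of_real]
        smooth_on_linear[OF _ bounded_linear_cnj] smooth_on_nth open_V smooth smooth_E assms(1))
  ultimately have "smooth_on V (lam \<mu>)"
    by (subst smooth_on_cong[OF open_V]) auto
  then show ?thesis using assms(2) by (rule smooth_on_differentiable)
qed

text \<open>The annihilator of the distribution is parallel along the distribution. The product rule applies to \<open>g\<close>,
  with all coefficients equal to 1, and to \<open>\<psi>\<close>, with coefficients \<open>lam \<mu>\<close> and \<open>- lam \<mu>\<close>. The covariant
  derivative of \<open>g\<close> is zero and that of \<open>\<psi>\<close> vanishes on the distribution, and these are the two equations
  from which the components of the covariant derivatives of the \<open>\<theta> \<mu>\<close> are seen to vanish.\<close>

lemma geodesic:
  assumes x: "x \<in> V" and X: "X \<in> null_dist x" and Y: "Y \<in> null_dist x" and \<rho>: "\<rho> \<in> {1..m}"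
  shows "(\<Sum>k\<in>UNIV. X $ k * form_apply (cov_form g (\<theta> \<rho>) x k) Y) = 0"
proof -
  interpret F: null_coframe_at m "g x" "\<psi> x" "\<lambda>\<mu>. lam \<mu> x" "\<lambda>\<mu>. \<theta> \<mu> x" by (rule at[OF x])
  note D = null_dist_at[OF x]
  let ?N = "\<lambda>\<mu> k. cov_form g (\<theta> \<mu>) x k"
  let ?n = "\<lambda>\<mu>. \<Sum>k\<in>UNIV. X $ k *s ?N \<mu> k"
  note diff = smooth_on_differentiable[OF _ x]
  have d\<theta>: "\<theta> \<mu> differentiable (at x)" if "\<mu> \<in> {1..m}" for \<mu>
    using diff smooth(3)[OF that] .
  have "form_apply (?n \<rho>) Y = 0"
  proof (rule F.D_geodesic_algebra[OF _ _ \<rho>])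
    fix Y Z assume YZ: "Y \<in> F.D" "Z \<in> F.D"
    then have Y0: "form_apply (\<theta> \<mu> x) Y = 0" and Z0: "form_apply (\<theta> \<mu> x) Z = 0" if "\<mu> \<in> {1..m}" for \<mu>
      using that by (auto simp: F.D_def)
    have "cbil (cov_deriv g g x (axis k 1)) Y Z = (\<Sum>\<mu>=1..m.
      1 * (form_apply (?N \<mu> k) Y * form_apply (conj_form (\<theta> \<mu> x)) Z)
      + 1 * (form_apply (conj_form (\<theta> \<mu> x)) Y * form_apply (?N \<mu> k) Z))" for k
      by (rule cov_deriv_null_sum[OF open_V x, where p="\<lambda>_ _. 1" and q="\<lambda>_ _. 1"])
        (use coframe_eqs(1) diff[OF smooth(1)] d\<theta> Y0 Z0 in auto)
    moreover have "cov_deriv g g x (axis k 1) = 0" for k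
      using metric by (intro cov_deriv_metric[OF open_V x]) (auto simp: x)
    ultimately have "(\<Sum>\<mu>=1..m.
      1 * (form_apply (?N \<mu> k) Y * form_apply (conj_form (\<theta> \<mu> x)) Z)
      + 1 * (form_apply (conj_form (\<theta> \<mu> x)) Y * form_apply (?N \<mu> k) Z)) = 0" for k
      by (simp add: cbil_def)
    then have "(\<Sum>k\<in>UNIV. X $ k * (\<Sum>\<mu>=1..m.
      1 * (form_apply (?N \<mu> k) Y * form_apply (conj_form (\<theta> \<mu> x)) Z)
      + 1 * (form_apply (conj_form (\<theta> \<mu> x)) Y * form_apply (?N \<mu> k) Z))) = 0"
      by (simp only: mult_zero_right sum.neutral_const)
    then show "(\<Sum>\<mu>=1..m. form_apply (?n \<mu>) Y * form_apply (F.c \<mu>) Z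
      + form_apply (F.c \<mu>) Y * form_apply (?n \<mu>) Z) = 0"
      unfolding sum_contract by simp
  next
    fix Y Z assume YZ: "Y \<in> F.D" "Z \<in> F.D"
    then have Y0: "form_apply (\<theta> \<mu> x) Y = 0" and Z0: "form_apply (\<theta> \<mu> x) Z = 0" if "\<mu> \<in> {1..m}" for \<mu>
      using that by (auto simp: F.D_def)
    have nabla: "cbil (cov_deriv g \<psi> x (axis k 1)) Y Z = (\<Sum>\<mu>=1..m.
      lam \<mu> x * (form_apply (?N \<mu> k) Y * form_apply (conj_form (\<theta> \<mu> x)) Z)
      + (- lam \<mu> x) * (form_apply (conj_form (\<theta> \<mu> x)) Y * form_apply (?N \<mu> k) Z))" for k
    proof (rule cov_deriv_null_sum[OF open_V x, where p=lam and q="\<lambda>\<mu> y. - lam \<mu> y"])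
      fix y i j assume "y \<in> V"
      from null_coframe_at.P_nth[OF at[OF this]]
      show "complex_of_real (\<psi> y $ i $ j) = (\<Sum>\<mu>=1..m. lam \<mu> y * (\<theta> \<mu> y $ i * cnj (\<theta> \<mu> y $ j))
        + (- lam \<mu> y) * (cnj (\<theta> \<mu> y $ i) * \<theta> \<mu> y $ j))" by simp
    qed (use diff[OF smooth(2)] d\<theta> Y0 Z0 x differentiable_lam in \<open>auto intro: differentiable_minus\<close>)
    define \<sigma> where "\<sigma> = (\<lambda>y. inner_2form (g y) (\<psi> y) (\<omega> y))"
    have xU: "x \<in> U" using x VU by blast
    have ham: "cov_deriv g \<psi> x X = (1/2) *\<^sub>R
          (wedge (differential \<sigma> x) (J_form (g x) (J x) (flat (g x) X))
           - wedge (J_form (g x) (J x) (differential \<sigma> x)) (flat (g x) X))" for X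
      using hamiltonian xU unfolding hamiltonian_2form_def \<sigma>_def Let_def by blast
    have "J x ** J x = - mat 1" "transpose (J x) ** g x ** J x = g x" "transpose (J x) ** \<psi> x ** J x = \<psi> x"
      using kaehler hamiltonian xU
      by (auto simp: kaehler_def complex_structure_def hamiltonian_2form_def orthogonal_structure_iff)
    then have JX: "map_matrix complex_of_real (J x) *v X \<in> F.D"
      using F.D_invariant X by (simp add: D)
    have "(\<Sum>k\<in>UNIV. X $ k * cbil (cov_deriv g \<psi> x (axis k 1)) Y Z) = 0"
      using F.D_isotropic YZ JX X metric(3)[OF x]
      by (intro hamiltonian_rhs_vanishes[OF _ ham]) (auto simp: D)
    then show "(\<Sum>\<mu>=1..m. lam \<mu> x * (form_apply (?n \<mu>) Y * form_apply (F.c \<mu>) Z)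
      - lam \<mu> x * (form_apply (F.c \<mu>) Y * form_apply (?n \<mu>) Z)) = 0"
      unfolding nabla sum_contract by simp
  next
    show "Y \<in> F.D" using Y by (simp add: D)
  qed
  then show ?thesis by (simp add: form_apply_sum_left)
qed

lemma form_apply_pd_section:
  assumes "open W" "x \<in> W" "\<alpha> differentiable (at x)" "Y differentiable (at x)"
    and "\<And>y. y \<in> W \<Longrightarrow> form_apply (\<alpha> y) (Y y) = 0"
  shows "form_apply (\<alpha> x) (pd k Y x) = - form_apply (pd k \<alpha> x) (Y x)"
proof -
  note nth = differentiable_nth[OF assms(3)] differentiable_nth[OF assms(4)]
  have "0 = pd k (\<lambda>y. \<Sum>i\<in>UNIV. \<alpha> y $ i * Y y $ i) x"
    using pd_cong_open[OF assms(1,2), of "\<lambda>y. form_apply (\<alpha> y) (Y y)" "\<lambda>y. 0"] assms(5)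
    by (simp add: form_apply_def)
  also have "\<dots> = (\<Sum>i\<in>UNIV. pd k (\<lambda>y. \<alpha> y $ i * Y y $ i) x)"
    by (rule pd_sum) (intro differentiable_bilinear[OF bounded_bilinear_mult] nth)
  also have "\<dots> = (\<Sum>i\<in>UNIV. \<alpha> x $ i * pd k Y x $ i + pd k \<alpha> x $ i * Y x $ i)"
    by (simp only: pd_mult[OF nth] pd_nth[OF assms(3)] pd_nth[OF assms(4)])
  finally show ?thesis by (simp add: form_apply_def sum.distrib eq_neg_iff_add_eq_0)
qed

text \<open>On sections of the distribution a form \<open>\<theta> \<mu>\<close> evaluates the bracket to minus its exterior
  derivative, which is the skew part of its covariant derivative because the connection is torsion-free.\<close>

lemma integrable: "integrable_distribution V null_dist"
  unfolding integrable_distribution_def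
proof (intro allI impI ballI, elim conjE)
  fix W X Y x
  assume W: "open W" "W \<subseteq> V" and XY: "smooth_on W X" "smooth_on W Y"
    and sec: "\<forall>x\<in>W. X x \<in> null_dist x" "\<forall>x\<in>W. Y x \<in> null_dist x" and xW: "x \<in> W"
  have x: "x \<in> V" using W xW by blast
  note diff = smooth_on_differentiable[OF XY(1) xW] smooth_on_differentiable[OF XY(2) xW]
  have "form_apply (\<theta> \<mu> x) (lie_bracket X Y x) = 0" if \<mu>: "\<mu> \<in> {1..m}" for \<mu>
  proof -
    let ?d = "\<lambda>k. pd k (\<theta> \<mu>) x"
    let ?\<Gamma> = "\<lambda>k i. \<Sum>l\<in>UNIV. complex_of_real (christoffel g x l k i) * \<theta> \<mu> x $ l"
    note d\<theta> = smooth_on_differentiable[OF smooth(3)[OF \<mu>] x]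
    have \<theta>Y: "form_apply (\<theta> \<mu> x) (pd k Y x) = - form_apply (?d k) (Y x)"
      and \<theta>X: "form_apply (\<theta> \<mu> x) (pd k X x) = - form_apply (?d k) (X x)" for k
      using sec \<mu> by (auto intro!: form_apply_pd_section[OF W(1) xW d\<theta>] diff simp: null_dist_def)
    have cov: "form_apply (cov_form g (\<theta> \<mu>) x k) v = form_apply (?d k) v - (\<Sum>i\<in>UNIV. ?\<Gamma> k i * v $ i)" for k v
      by (simp add: form_apply_def cov_form_def left_diff_distrib sum_subtractf)
    have \<Gamma>_sym: "?\<Gamma> k i = ?\<Gamma> i k" for k i
      by (subst christoffel_sym[OF open_V x]) (auto simp: metric)
    have "(\<Sum>k\<in>UNIV. \<Sum>i\<in>UNIV. X x $ k * (?\<Gamma> k i * Y x $ i)) = (\<Sum>k\<in>UNIV. \<Sum>i\<in>UNIV. Y x $ k * (?\<Gamma> k i * X x $ i))"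
      by (subst sum.swap) (intro sum.cong refl, subst \<Gamma>_sym, simp only: mult_ac)
    moreover have "(\<Sum>k\<in>UNIV. X x $ k * form_apply (?d k) (Y x)) = (\<Sum>k\<in>UNIV. \<Sum>i\<in>UNIV. X x $ k * (?\<Gamma> k i * Y x $ i))"
      using geodesic[OF x, of "X x" "Y x", OF _ _ \<mu>] sec xW
      by (simp add: cov right_diff_distrib sum_subtractf sum_distrib_left)
    moreover have "(\<Sum>k\<in>UNIV. Y x $ k * form_apply (?d k) (X x)) = (\<Sum>k\<in>UNIV. \<Sum>i\<in>UNIV. Y x $ k * (?\<Gamma> k i * X x $ i))"
      using geodesic[OF x, of "Y x" "X x", OF _ _ \<mu>] sec xW
      by (simp add: cov right_diff_distrib sum_subtractf sum_distrib_left)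
    ultimately show ?thesis
      by (simp add: lie_bracket_def form_apply_sum \<theta>X \<theta>Y sum_negf sum_subtractf)
  qed
  then show "lie_bracket X Y x \<in> null_dist x" by (simp add: null_dist_def)
qed

end

section \<open>Smooth dependence of eigenvectors\<close>

lemma bounded_bilinear_matrix_vector: "bounded_bilinear (\<lambda>(A :: complex^'k^'k::finite) v. A *v v)"
  unfolding bilinear_conv_bounded_bilinear[symmetric] bilinear_def
  by (auto intro!: linearI simp: matrix_vector_mult_def vec_eq_iff sum.distrib algebra_simps
      scaleR_sum_right)

lemma bounded_bilinear_scalar_vector: "bounded_bilinear (\<lambda>c (v :: complex^'k::finite). c *s v)"
  unfolding bilinear_conv_bounded_bilinear[symmetric] bilinear_def
  by (auto intro!: linearI simp: vec_eq_iff algebra_simps)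

lemma bounded_linear_form_apply: "bounded_linear (form_apply \<alpha>)"
  unfolding linear_conv_bounded_linear[symmetric]
  by (auto intro!: linearI simp: form_apply_def sum.distrib algebra_simps scaleR_sum_right)

lemma frechet_derivative_pd:
  fixes f :: "real^'n::finite \<Rightarrow> 'b::real_normed_vector"
  assumes "f differentiable (at x)"
  shows "frechet_derivative f (at x) h = (\<Sum>k\<in>UNIV. h $ k *\<^sub>R pd k f x)"
proof -
  interpret linear "frechet_derivative f (at x)"
    using assms by (rule linear_frechet_derivative)
  have "h = (\<Sum>k\<in>UNIV. h $ k *\<^sub>R axis k 1)"
    by (simp add: vec_eq_iff sum_mult_axis[of "\<lambda>k. h $ k", unfolded axis_def] axis_def if_distrib cong: if_cong)
  then have "frechet_derivative f (at x) h = frechet_derivative f (at x) (\<Sum>k\<in>UNIV. h $ k *\<^sub>R axis k 1)"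
    by simp
  then show ?thesis by (simp add: sum scaleR pd_def)
qed

text \<open>The eigenvalue is read off from the eigenvector by a linear functional \<open>l\<close>; this turns the eigenvalue
  problem with a normalised eigenvector into one quadratic equation for \<open>v\<close>.\<close>

lemma implicit_eigenvector:
  fixes A B :: "real^'n::finite \<Rightarrow> complex^'k^'k::finite" and l v0 :: "complex^'k"
  assumes U: "open U" and p: "p \<in> U" and sA: "smooth_on U A" and sB: "smooth_on U B"
    and eq: "A p *v v0 = form_apply l v0 *s (B p *v v0)"
    and inj: "\<And>w. A p *v w = form_apply l v0 *s (B p *v w) + form_apply l w *s (B p *v v0) \<Longrightarrow> w = 0"
  obtains W v where "open W" "p \<in> W" "W \<subseteq> U" "v p = v0"
    "\<And>x. x \<in> W \<Longrightarrow> v differentiable (at x)"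
    "\<And>x. x \<in> W \<Longrightarrow> A x *v v x = form_apply l (v x) *s (B x *v v x)"
proof -
  define A' where "A' x = frechet_derivative A (at x)" for x
  define B' where "B' x = frechet_derivative B (at x)" for x
  have dA: "(A has_derivative A' x) (at x)" and dB: "(B has_derivative B' x) (at x)" if "x \<in> U" for x
    unfolding A'_def B'_def using that sA sB
    by (auto intro: pd_has_derivative smooth_on_differentiable)
  define F where "F z = A (fst z) *v snd z - form_apply l (snd z) *s (B (fst z) *v snd z)" for z :: "(real^'n) \<times> (complex^'k)"
  define f where "f z = (fst z, F z)" for z
  define F' where "F' z h = (A (fst z) *v snd h + A' (fst z) (fst h) *v snd z)
      - (form_apply l (snd z) *s (B (fst z) *v snd h + B' (fst z) (fst h) *v snd z)
         + form_apply l (snd h) *s (B (fst z) *v snd z))" for z h :: "(real^'n) \<times> (complex^'k)"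
  define f' where "f' z = Blinfun (\<lambda>h. (fst h, F' z h))" for z
  let ?U = "U \<times> (UNIV :: (complex^'k) set)"
  have dF: "(F has_derivative F' z) (at z)" if "z \<in> ?U" for z
  proof -
    have z: "fst z \<in> U" using that by auto
    have 1: "((\<lambda>z. A (fst z)) has_derivative (\<lambda>h. A' (fst z) (fst h))) (at z)"
      "((\<lambda>z. B (fst z)) has_derivative (\<lambda>h. B' (fst z) (fst h))) (at z)"
      using has_derivative_compose[OF has_derivative_fst[OF has_derivative_ident] dA[OF z]]
        has_derivative_compose[OF has_derivative_fst[OF has_derivative_ident] dB[OF z]] by simp_all
    have 2: "(snd has_derivative snd) (at z)"
      by (intro bounded_linear_imp_has_derivative bounded_linear_snd)
    show ?thesis
      unfolding F_def[abs_def] F'_def[abs_def]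
      by (intro has_derivative_diff
          bounded_bilinear.FDERIV[OF bounded_bilinear_matrix_vector]
          bounded_bilinear.FDERIV[OF bounded_bilinear_scalar_vector]
          bounded_linear.has_derivative[OF bounded_linear_form_apply] 1 2)
  qed
  then have df: "(f has_derivative (\<lambda>h. (fst h, F' z h))) (at z)" if "z \<in> ?U" for z
    unfolding f_def[abs_def] using that by (intro has_derivative_Pair has_derivative_fst has_derivative_ident)
  then have bl: "bounded_linear (\<lambda>h. (fst h, F' z h))" if "z \<in> ?U" for z
    using that has_derivative_bounded_linear by blast
  then have f'_apply: "blinfun_apply (f' z) = (\<lambda>h. (fst h, F' z h))" if "z \<in> ?U" for z
    unfolding f'_def using that by (simp add: bounded_linear_Blinfun_apply)
  have cont: "continuous_on ?U f'"
  proof (rule continuous_on_blinfun_componentwise)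
    fix h :: "(real^'n) \<times> (complex^'k)"
    have fst: "continuous_on ?U fst" and snd: "continuous_on ?U snd" by (auto intro: continuous_intros)
    have c: "continuous_on ?U (\<lambda>z. C (fst z))" if "continuous_on U C" for C :: "real^'n \<Rightarrow> complex^'k^'k"
      using continuous_on_compose2[OF that fst] by auto
    have pd: "continuous_on U (pd k C)" if "smooth_on U C" for k and C :: "real^'n \<Rightarrow> complex^'k^'k"
      using smooth_on_continuous[OF smooth_on_pd[OF that]] .
    have c': "continuous_on ?U (\<lambda>z. frechet_derivative C (at (fst z)) (fst h))" if "smooth_on U C"
      for C :: "real^'n \<Rightarrow> complex^'k^'k"
    proof -
      have "continuous_on ?U (\<lambda>z. \<Sum>k\<in>UNIV. fst h $ k *\<^sub>R pd k C (fst z))"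
        by (intro continuous_intros c pd that)
      then show ?thesis
        by (rule continuous_on_eq) (auto simp: frechet_derivative_pd smooth_on_differentiable[OF that])
    qed
    have "continuous_on ?U (\<lambda>z. (fst h, F' z h))"
      unfolding F'_def A'_def B'_def
      by (intro continuous_intros bounded_bilinear.continuous_on[OF bounded_bilinear_matrix_vector]
          bounded_bilinear.continuous_on[OF bounded_bilinear_scalar_vector]
          bounded_linear.continuous_on[OF bounded_linear_form_apply] c c' snd sA sB smooth_on_continuous)
    then show "continuous_on ?U (\<lambda>z. blinfun_apply (f' z) h)"
      by (rule continuous_on_eq) (auto simp: f'_apply)
  qed
  have p0: "(p, v0) \<in> ?U" using p by simp
  have lin: "linear (\<lambda>h. (fst h, F' (p, v0) h))"
    using bl[OF p0] by (rule bounded_linear.linear)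
  have "inj (\<lambda>h. (fst h, F' (p, v0) h))"
    unfolding linear_injective_0[OF lin]
  proof (intro allI impI)
    fix h assume 0: "(fst h, F' (p, v0) h) = 0"
    then have "fst h = 0" by (simp add: zero_prod_def)
    moreover have "A' p 0 = 0" "B' p 0 = 0"
      using dA[OF p] dB[OF p] by (auto dest: has_derivative_linear intro: linear_0)
    ultimately have "A p *v snd h = form_apply l v0 *s (B p *v snd h) + form_apply l (snd h) *s (B p *v v0)"
      using 0 by (simp add: zero_prod_def F'_def)
    then have "snd h = 0" by (rule inj)
    with \<open>fst h = 0\<close> show "h = 0" by (simp add: prod_eq_iff)
  qed
  then obtain inv where inv: "linear inv" "inv \<circ> (\<lambda>h. (fst h, F' (p, v0) h)) = id"
    using linear_injective_left_inverse[OF lin] by blast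
  have "bounded_linear inv"
    using inv(1) linear_conv_bounded_linear by blast
  then have inv': "Blinfun inv o\<^sub>L f' (p, v0) = id_blinfun"
    using inv(2)
    by (intro blinfun_eqI) (auto simp: f'_apply[OF p0] bounded_linear_Blinfun_apply fun_eq_iff)
  have oU: "open ?U" using U by (simp add: open_Times)
  have df': "(f has_derivative blinfun_apply (f' z)) (at z)" if "z \<in> ?U" for z
    using df[OF that] f'_apply[OF that] by simp
  obtain U' V' G G' where IFT: "open U'" "U' \<subseteq> ?U" "(p, v0) \<in> U'" "open V'" "f (p, v0) \<in> V'"
      "homeomorphism U' V' f G" "\<And>y. y \<in> V' \<Longrightarrow> (G has_derivative (G' y)) (at y)"
    by (rule inverse_function_theorem[OF oU df' cont p0 inv']) (assumption, rule that)
  define W where "W = (\<lambda>x. (x, 0 :: complex^'k)) -` V'"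
  define v where "v x = snd (G (x, 0))" for x
  have fp: "f (p, v0) = (p, 0)"
    using eq by (simp add: f_def F_def)
  have G: "fst (G (x, 0)) = x" "F (x, v x) = 0" "x \<in> U" if "x \<in> W" for x
  proof -
    have "f (G (x, 0)) = (x, 0)" "G (x, 0) \<in> U'"
      using that IFT(6) by (auto simp: W_def homeomorphism_def)
    moreover from this show "fst (G (x, 0)) = x" by (simp add: f_def)
    ultimately show "F (x, v x) = 0" "x \<in> U"
      using IFT(2) by (auto simp: f_def v_def)
  qed
  show thesis
  proof (rule that)
    show "open W"
      unfolding W_def by (intro open_vimage IFT(4) continuous_intros)
    show "p \<in> W" using IFT(5) fp by (simp add: W_def)
    show "W \<subseteq> U" using G(3) by blast
    show "v p = v0"
      using IFT(3,6) fp by (auto simp: v_def homeomorphism_def)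
    show "A x *v v x = form_apply l (v x) *s (B x *v v x)" if "x \<in> W" for x
      using G(2)[OF that] by (simp add: F_def)
    show "v differentiable (at x)" if "x \<in> W" for x
    proof -
      have "((\<lambda>x. (x, 0 :: complex^'k)) has_derivative (\<lambda>h. (h, 0))) (at x)"
        by (auto intro!: derivative_eq_intros)
      moreover have "(G has_derivative G' (x, 0)) (at (x, 0))"
        using that IFT(7) by (simp add: W_def)
      ultimately have "((\<lambda>x. G (x, 0)) has_derivative (\<lambda>h. G' (x, 0) (h, 0))) (at x)"
        by (rule has_derivative_compose)
      then show ?thesis
        unfolding v_def[abs_def] differentiable_def using has_derivative_snd by blast
    qed
  qed
qed

lemma bordered_matrix_mult:
  fixes A B :: "complex^'k^'k::finite"
  shows "(\<chi> i j. A $ i $ j - c * B $ i $ j - d $ i * l $ j) *v w = A *v w - c *s (B *v w) - form_apply l w *s d"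
  by (simp add: vec_eq_iff matrix_vector_mult_def form_apply_def left_diff_distrib right_diff_distrib
      sum_subtractf sum_distrib_left sum_distrib_right mult_ac)

text \<open>Differentiating the equation expresses the derivatives of \<open>v\<close> rationally through \<open>A\<close>, \<open>B\<close>, their
  derivatives and \<open>v\<close>, so each order of differentiability gives the next one.\<close>

lemma smooth_implicit_eigenvector:
  fixes A B :: "real^'n::finite \<Rightarrow> complex^'k^'k::finite" and l v0 :: "complex^'k"
  assumes U: "open U" and p: "p \<in> U" and sA: "smooth_on U A" and sB: "smooth_on U B"
    and eq: "A p *v v0 = form_apply l v0 *s (B p *v v0)"
    and inj: "\<And>w. A p *v w = form_apply l v0 *s (B p *v w) + form_apply l w *s (B p *v v0) \<Longrightarrow> w = 0"
  obtains V v where "open V" "p \<in> V" "V \<subseteq> U" "v p = v0" "smooth_on V v"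
    "\<And>x. x \<in> V \<Longrightarrow> A x *v v x = form_apply l (v x) *s (B x *v v x)"
proof -
  obtain W v where W: "open W" "p \<in> W" "W \<subseteq> U" and vp: "v p = v0"
    and dv: "\<And>x. x \<in> W \<Longrightarrow> v differentiable (at x)"
    and ev: "\<And>x. x \<in> W \<Longrightarrow> A x *v v x = form_apply l (v x) *s (B x *v v x)"
    using implicit_eigenvector[OF assms] by blast
  \<comment> \<open>The derivative of the equation with respect to \<open>v\<close>.\<close>
  define K where "K x = (\<chi> i j. A x $ i $ j - form_apply l (v x) * B x $ i $ j - (B x *v v x) $ i * l $ j)" for x
  have K: "K x *v w = A x *v w - form_apply l (v x) *s (B x *v w) - form_apply l w *s (B x *v v x)" for x w
    unfolding K_def by (rule bordered_matrix_mult)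
  have CkA: "Ck_on k W (\<lambda>x. A x $ i $ j)" "Ck_on k W (\<lambda>x. B x $ i $ j)"
    "Ck_on k W (\<lambda>x. pd r A x $ i $ j)" "Ck_on k W (\<lambda>x. pd r B x $ i $ j)" for k i j r
    using smooth_on_subset[OF sA W(3)] smooth_on_subset[OF sB W(3)]
      smooth_on_subset[OF smooth_on_pd[OF sA] W(3)] smooth_on_subset[OF smooth_on_pd[OF sB] W(3)] W(1)
    by (auto simp: smooth_on_def intro!: Ck_on_nth)
  have CkK: "Ck_on k X (\<lambda>x. K x $ i $ j)" if "Ck_on k X v" "open X" "X \<subseteq> W" for k i j X
  proof -
    show ?thesis
      unfolding K_def form_apply_def matrix_vector_mult_def vec_lambda_beta
      by (intro CkA[THEN Ck_on_subset, OF that(3)] Ck_on_diff Ck_on_mult Ck_on_sum Ck_on_const Ck_on_nth that)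
  qed
  have "Ck_on 0 W v" using dv by (simp add: continuous_at_imp_continuous_on differentiable_imp_continuous_within)
  from Ck_on_det[OF W(1) CkK[OF this W(1) subset_refl]]
  have cont: "continuous_on W (\<lambda>x. det (K x))" by simp
  define V where "V = W \<inter> (\<lambda>x. det (K x)) -` (- {0})"
  have V: "open V" "V \<subseteq> W"
    unfolding V_def using continuous_open_preimage[OF cont W(1)] by auto
  have "K p *v w = 0 \<Longrightarrow> w = 0" for w
    using inj[of w] by (simp add: K vp algebra_simps)
  then have "invertible (K p)"
    by (metis invertible_left_inverse matrix_left_invertible_ker)
  then have pV: "p \<in> V" using W(2) by (simp add: V_def invertible_det_nz)
  have "Ck_on k V v" for k
  proof (induction k)
    case 0
    show ?case by (rule Ck_on_subset[OF \<open>Ck_on 0 W v\<close> V(2)])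
  next
    case (Suc k)
    have "Ck_on k V (pd r v)" for r
    proof (rule Ck_on_solution[where A=K])
      let ?b = "\<lambda>x. form_apply l (v x) *s (pd r B x *v v x) - pd r A x *v v x"
      show "Ck_on k V (\<lambda>x. ?b x $ i)" for i
      proof -
        show ?thesis
          unfolding form_apply_def matrix_vector_mult_def vec_lambda_beta vector_minus_component vector_smult_component
          by (intro CkA[THEN Ck_on_subset, OF V(2)] Ck_on_diff Ck_on_mult Ck_on_sum Ck_on_const Ck_on_nth Suc V)
      qed
      show "Ck_on k V (\<lambda>x. K x $ i $ j)" for i j by (rule CkK[OF Suc V])
      show "det (K x) \<noteq> 0" if "x \<in> V" for x using that by (simp add: V_def)
      show "K x *v pd r v x = ?b x" if "x \<in> V" for x
      proof -
        have xW: "x \<in> W" and xU: "x \<in> U" using that V W by auto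
        note d = smooth_on_differentiable[OF sA xU] smooth_on_differentiable[OF sB xU] dv[OF xW]
        note mv = bounded_bilinear_matrix_vector and sv = bounded_bilinear_scalar_vector
          and fa = bounded_linear_form_apply
        have "A x *v pd r v x + pd r A x *v v x = pd r (\<lambda>x. A x *v v x) x"
          by (rule pd_bilinear[OF mv d(1,3), symmetric])
        also have "\<dots> = pd r (\<lambda>x. form_apply l (v x) *s (B x *v v x)) x"
          by (rule pd_cong_open[OF W(1) xW ev])
        also have "\<dots> = form_apply l (v x) *s (B x *v pd r v x + pd r B x *v v x)
            + form_apply l (pd r v x) *s (B x *v v x)"
          by (simp only: pd_bilinear[OF sv differentiable_linear[OF fa d(3)] differentiable_bilinear[OF mv d(2,3)]]
              pd_bilinear[OF mv d(2,3)] pd_linear[OF fa d(3)])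
        finally show ?thesis
          unfolding K by (simp add: vec_eq_iff algebra_simps)
      qed
    qed (rule V)
    then show ?case using dv V by auto
  qed
  then have "smooth_on V v" by (simp add: smooth_on_def)
  then show thesis
    using that[of V v] V W pV vp ev by blast
qed

section \<open>Existence of adapted null coframes\<close>

text \<open>Computing \<open>P(v, w)\<close> from either argument gives \<open>k G(v, w) = - l G(v, w)\<close>. This is the bilinear and not
  the Hermitian product, which is why opposite rather than equal eigenvalues are exceptional.\<close>

lemma eigenvectors_orthogonal:
  assumes "transpose G = G" "transpose P = - P"
    and "lower P v = k *s lower G v" "lower P w = l *s lower G w" "k + l \<noteq> 0"
  shows "cbil G v w = 0"
proof -
  have "cbil P v w = k * cbil G v w" "cbil P w v = l * cbil G w v"
    using assms(3,4) by (simp_all flip: form_apply_lower)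
  then have "(k + l) * cbil G v w = 0"
    using cbil_skew[OF assms(2), of v w] cbil_sym[OF assms(1), of v w] by algebra
  then show ?thesis using assms(5) by simp
qed

lemma eigenvector_conj:
  assumes "lower P v = k *s lower G v"
  shows "lower P (conj_form v) = cnj k *s lower G (conj_form v)"
  using arg_cong[OF assms, of conj_form] by (simp add: conj_form_lower)

text \<open>The product of \<open>v\<close> with its conjugate is not zero, so their eigenvalues \<open>k\<close> and \<open>cnj k\<close> are opposite.\<close>

lemma eigenvalue_imaginary:
  assumes "transpose G = G" "transpose P = - P" "\<And>v. v \<noteq> 0 \<Longrightarrow> v \<bullet> (G *v v) > 0"
    and "v \<noteq> 0" "lower P v = k *s lower G v"
  shows "cnj k = - k"
proof -
  have "cbil G v (conj_form v) \<noteq> 0"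
    using cbil_hermitian_pos[OF assms(1,3,4)] by force
  then have "k + cnj k = 0"
    using eigenvectors_orthogonal[OF assms(1,2,5) eigenvector_conj[OF assms(5)]] by blast
  then show ?thesis by (simp add: eq_neg_iff_add_eq_0 add.commute)
qed

text \<open>One eigenvector from each conjugate pair, at a point; the upper half-plane singles out one member of
  each pair, which keeps \<open>k \<mu> + k \<nu>\<close> away from zero.\<close>

locale null_eigenframe =
  fixes m :: nat and G P :: "real^'n^'n::finite" and k :: "nat \<Rightarrow> complex" and w :: "nat \<Rightarrow> complex^'n"
  assumes dim: "CARD('n) = 2 * m"
    and G_sym: "transpose G = G" and G_pos: "\<And>v. v \<noteq> 0 \<Longrightarrow> v \<bullet> (G *v v) > 0"
    and P_skew: "transpose P = - P"
    and w_nz: "\<And>\<mu>. \<mu> \<in> {1..m} \<Longrightarrow> w \<mu> \<noteq> 0"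
    and w_eigen: "\<And>\<mu>. \<mu> \<in> {1..m} \<Longrightarrow> lower P (w \<mu>) = k \<mu> *s lower G (w \<mu>)"
    and k_pos: "\<And>\<mu>. \<mu> \<in> {1..m} \<Longrightarrow> Im (k \<mu>) > 0"
    and k_inj: "inj_on k {1..m}"
begin

text \<open>Normalised so that the product with the conjugate is 1, the value required of a dual frame.\<close>

definition u :: "nat \<Rightarrow> complex^'n" where
  "u \<mu> = complex_of_real (inverse (sqrt (Re (cbil G (w \<mu>) (conj_form (w \<mu>)))))) *s w \<mu>"

definition a :: "nat \<Rightarrow> complex^'n" where "a \<mu> = lower G (u \<mu>)"

lemma form_apply_a: "form_apply (a \<mu>) y = cbil G (u \<mu>) y"
  "form_apply (conj_form (a \<mu>)) y = cbil G (conj_form (u \<mu>)) y"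
  by (simp_all add: a_def conj_form_lower form_apply_lower)

lemma u_eigen:
  assumes "\<mu> \<in> {1..m}"
  shows "lower P (u \<mu>) = k \<mu> *s lower G (u \<mu>)"
    and "lower P (conj_form (u \<mu>)) = (- k \<mu>) *s lower G (conj_form (u \<mu>))"
proof -
  have scale: "lower B (c *s v) = c *s lower B v" for B :: "real^'n^'n" and c v
    by (simp add: lower_def vec_eq_iff sum_distrib_left mult_ac)
  show 1: "lower P (u \<mu>) = k \<mu> *s lower G (u \<mu>)"
    using w_eigen[OF assms] by (simp add: u_def scale vector_smult_assoc mult.commute)
  show "lower P (conj_form (u \<mu>)) = (- k \<mu>) *s lower G (conj_form (u \<mu>))"
    using eigenvector_conj[OF 1] eigenvalue_imaginary[OF G_sym P_skew G_pos w_nz w_eigen] assms by simp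
qed

lemma k_distinct:
  assumes "\<mu> \<in> {1..m}" "\<nu> \<in> {1..m}"
  shows "k \<mu> + k \<nu> \<noteq> 0" "\<mu> \<noteq> \<nu> \<Longrightarrow> k \<mu> \<noteq> k \<nu>"
proof -
  have "Im (k \<mu> + k \<nu>) > 0" using k_pos assms by (simp add: add_pos_pos)
  then show "k \<mu> + k \<nu> \<noteq> 0" by force
qed (use k_inj assms in \<open>auto dest: inj_onD\<close>)

lemma u_products:
  assumes \<mu>: "\<mu> \<in> {1..m}" and \<nu>: "\<nu> \<in> {1..m}"
  shows "cbil G (u \<mu>) (u \<nu>) = 0" "cbil G (conj_form (u \<mu>)) (conj_form (u \<nu>)) = 0"
    "cbil G (u \<mu>) (conj_form (u \<nu>)) = (if \<mu> = \<nu> then 1 else 0)"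
    "cbil G (conj_form (u \<mu>)) (u \<nu>) = (if \<mu> = \<nu> then 1 else 0)"
proof -
  show 0: "cbil G (u \<mu>) (u \<nu>) = 0"
    using eigenvectors_orthogonal[OF G_sym P_skew u_eigen(1)[OF \<mu>] u_eigen(1)[OF \<nu>]] k_distinct(1)[OF \<mu> \<nu>]
    by blast
  then show "cbil G (conj_form (u \<mu>)) (conj_form (u \<nu>)) = 0"
    by (simp flip: cnj_cbil)
  have *: "cbil G (u \<mu>) (conj_form (u \<nu>)) = (if \<mu> = \<nu> then 1 else 0)" if "\<mu> \<in> {1..m}" "\<nu> \<in> {1..m}" for \<mu> \<nu>
  proof (cases "\<mu> = \<nu>")
    case True
    obtain r where r: "r > 0" "cbil G (w \<mu>) (conj_form (w \<mu>)) = complex_of_real r"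
      using cbil_hermitian_pos[OF G_sym _ w_nz[OF \<open>\<mu> \<in> {1..m}\<close>]] G_pos by blast
    have "inverse (sqrt r) * (inverse (sqrt r) * r) = 1"
      using r(1) by (simp add: field_simps)
    then have "complex_of_real (inverse (sqrt r)) * (complex_of_real (inverse (sqrt r)) * complex_of_real r) = 1"
      by (metis of_real_1 of_real_mult)
    then show ?thesis
      using True r by (simp add: u_def)
  next
    case False
    then show ?thesis
      using eigenvectors_orthogonal[OF G_sym P_skew u_eigen(1)[OF that(1)] u_eigen(2)[OF that(2)]]
        k_distinct(2)[OF that] by simp
  qed
  show "cbil G (u \<mu>) (conj_form (u \<nu>)) = (if \<mu> = \<nu> then 1 else 0)"
    by (rule *[OF \<mu> \<nu>])
  show "cbil G (conj_form (u \<mu>)) (u \<nu>) = (if \<mu> = \<nu> then 1 else 0)"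
    using *[OF \<nu> \<mu>] cbil_sym[OF G_sym] by (simp add: eq_commute[of \<mu>])
qed

lemma expand: "y = (\<Sum>\<mu>=1..m. form_apply (a \<mu>) y *s conj_form (u \<mu>) + form_apply (conj_form (a \<mu>)) y *s u \<mu>)"
  using null_frame_iff[OF dim, of a "\<lambda>\<mu>. conj_form (u \<mu>)" "\<lambda>\<mu>. conj_form (a \<mu>)" u]
  by (simp add: form_apply_a u_products)

lemma cbil_expand:
  "cbil B y z = (\<Sum>\<mu>=1..m. form_apply (a \<mu>) y * cbil B (conj_form (u \<mu>)) z
    + form_apply (conj_form (a \<mu>)) y * cbil B (u \<mu>) z)"
  by (subst expand[of y]) (simp add: cbil_sum_left)

lemma G_eq: "complex_of_real (G $ i $ j) =
    (\<Sum>\<mu>=1..m. a \<mu> $ i * conj_form (a \<mu>) $ j + conj_form (a \<mu>) $ i * a \<mu> $ j)"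
  using cbil_expand[of G "axis i 1" "axis j 1"]
  by (simp only: cbil_axis form_apply_axis flip: form_apply_a)

lemma P_eq: "map_matrix complex_of_real P =
    (\<Sum>\<mu>=1..m. map_matrix ((*) (- k \<mu>)) (wedge (a \<mu>) (conj_form (a \<mu>))))"
proof -
  have "cbil P (u \<mu>) z = k \<mu> * form_apply (a \<mu>) z"
    "cbil P (conj_form (u \<mu>)) z = - k \<mu> * form_apply (conj_form (a \<mu>)) z" if "\<mu> \<in> {1..m}" for \<mu> z
    unfolding form_apply_lower[symmetric] u_eigen[OF that] by (simp_all add: form_apply_lower form_apply_a)
  then have "complex_of_real (P $ i $ j) = (\<Sum>\<mu>=1..m. form_apply (a \<mu>) (axis i 1) * (- k \<mu> * form_apply (conj_form (a \<mu>)) (axis j 1))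
      + form_apply (conj_form (a \<mu>)) (axis i 1) * (k \<mu> * form_apply (a \<mu>) (axis j 1)))" for i j
    using cbil_expand[of P "axis i 1" "axis j 1"] unfolding cbil_axis by (simp cong: sum.cong_simp)
  then show ?thesis
    by (simp add: vec_eq_iff form_apply_axis wedge_def algebra_simps)
qed

text \<open>By orthogonality the components of \<open>y\<close> along all other frame vectors vanish.\<close>

lemma eigenspace:
  assumes "\<mu> \<in> {1..m}" "lower P y = k \<mu> *s lower G y"
  shows "\<exists>c. y = c *s w \<mu>"
proof -
  have "form_apply (a \<nu>) y = 0" if "\<nu> \<in> {1..m}" for \<nu>
    unfolding form_apply_a
    using eigenvectors_orthogonal[OF G_sym P_skew u_eigen(1)[OF that] assms(2)] k_distinct(1)[OF that assms(1)]
    by blast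
  moreover have "form_apply (conj_form (a \<nu>)) y = 0" if "\<nu> \<in> {1..m}" "\<nu> \<noteq> \<mu>" for \<nu>
    unfolding form_apply_a
    using eigenvectors_orthogonal[OF G_sym P_skew u_eigen(2)[OF that(1)] assms(2)] k_distinct(2)[OF that(1) assms(1)] that(2)
    by simp
  ultimately have "y = (\<Sum>\<nu>=1..m. if \<nu> = \<mu> then form_apply (conj_form (a \<mu>)) y *s u \<mu> else 0)"
    by (subst expand[of y]) (intro sum.cong, auto)
  then have "y = form_apply (conj_form (a \<mu>)) y *s u \<mu>"
    using assms(1) by simp
  then show ?thesis by (metis u_def vector_smult_assoc)
qed

end

text \<open>Complex conjugation pairs the eigenvalues, which are imaginary and nonzero, so exactly half of
  them lie in the upper half-plane.\<close>

lemma ex_null_eigenframe: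
  fixes G P :: "real^'n^'n::finite"
  assumes dim: "CARD('n) = 2 * m" and G_sym: "transpose G = G"
    and G_pos: "\<And>v. v \<noteq> 0 \<Longrightarrow> v \<bullet> (G *v v) > 0" and P_skew: "transpose P = - P"
    and inv: "invertible (raise_index G P)" and card: "card (eigenvalues (raise_index G P)) = CARD('n)"
  obtains k w where "null_eigenframe m G P k w"
proof -
  let ?E = "eigenvalues (raise_index G P)"
  have E: "k \<in> ?E \<longleftrightarrow> (\<exists>v. v \<noteq> 0 \<and> lower P v = k *s lower G v)" for k
    using eigenvector_iff[OF metric_invertible[OF G_pos] G_sym] by (auto simp: eigenvalues_def)
  have im: "cnj k = - k" if "k \<in> ?E" for k
    using that eigenvalue_imaginary[OF G_sym P_skew G_pos] by (auto simp: E)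
  have cnjE: "cnj k \<in> ?E" if "k \<in> ?E" for k
    using that eigenvector_conj[of P _ k G] unfolding E by (metis conj_form_simps(3))
  have "0 \<notin> ?E"
  proof
    assume "0 \<in> ?E"
    then obtain v where "v \<noteq> 0" "map_matrix complex_of_real (raise_index G P) *v v = 0"
      by (auto simp: eigenvalues_def)
    moreover have "map_matrix complex_of_real (matrix_inv (raise_index G P)) *v
        (map_matrix complex_of_real (raise_index G P) *v v) = v"
      by (simp add: map_matrix_mult invertible_matrix_inv(2)[OF inv])
    ultimately show False by (metis matrix_vector_mult_0_right)
  qed
  let ?P = "{k \<in> ?E. Im k > 0}" and ?N = "{k \<in> ?E. Im k < 0}"
  have fin: "finite ?E" using card by (metis card.infinite zero_less_card_finite less_irrefl)
  have "Im k \<noteq> 0" if "k \<in> ?E" for k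
    using im[OF that] \<open>0 \<notin> ?E\<close> that by (auto simp: complex_eq_iff) (metis complex.expand zero_complex.simps)
  then have "?E = ?P \<union> ?N" by fastforce
  then have "card ?E = card ?P + card ?N"
    using fin by (subst card_Un_disjoint[symmetric]) auto
  moreover have "bij_betw cnj ?P ?N"
    by (rule bij_betw_byWitness[where f'=cnj]) (auto simp: cnjE)
  then have "card ?P = card ?N" by (rule bij_betw_same_card)
  ultimately have "card ?P = m" using dim card by simp
  then obtain k where k: "bij_betw k {1..m} ?P"
    using fin finite_same_card_bij[of "{1..m}" ?P] by auto
  then have kE: "k \<mu> \<in> ?P" if "\<mu> \<in> {1..m}" for \<mu>
    using that by (meson bij_betwE)
  then have "\<forall>\<mu>\<in>{1..m}. \<exists>v. v \<noteq> 0 \<and> lower P v = k \<mu> *s lower G v"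
    unfolding mem_Collect_eq E by blast
  then obtain w where "\<forall>\<mu>\<in>{1..m}. w \<mu> \<noteq> 0 \<and> lower P (w \<mu>) = k \<mu> *s lower G (w \<mu>)"
    by (metis (no_types, lifting))
  then have "null_eigenframe m G P k w"
    using assms kE k by unfold_locales (auto simp: bij_betw_def)
  then show thesis by (rule that)
qed

lemma smooth_on_cbil:
  assumes "open V" "smooth_on V B" "smooth_on V v" "smooth_on V w"
  shows "smooth_on V (\<lambda>x. cbil (B x) (v x) (w x))"
  unfolding cbil_def
  by (intro smooth_on_sum smooth_on_mult smooth_on_linear[OF _ bounded_linear_of_real] smooth_on_nth assms)

lemma smooth_on_conj_form: "open V \<Longrightarrow> smooth_on V v \<Longrightarrow> smooth_on V (\<lambda>x. conj_form (v x))"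
  unfolding conj_form_def
  by (intro smooth_on_vec) (simp_all add: smooth_on_linear[OF _ bounded_linear_cnj] smooth_on_nth)

text \<open>The eigenvectors at \<open>p\<close> with eigenvalues in the upper half-plane extend to smooth fields of
  eigenvectors. Their eigenvalues are continuous, so near \<open>p\<close> they stay distinct and in the upper
  half-plane, and the normalised fields are a frame whose metric duals are the coframe.\<close>

lemma ex_adapted_null_coframe:
  fixes g \<psi> :: "real^'n::finite \<Rightarrow> real^'n^'n"
  assumes dim: "CARD('n) = 2 * m" and U: "open U" and p: "p \<in> U" and g: "riemannian_metric U g"
    and s\<psi>: "smooth_on U \<psi>" and skew: "\<And>x. x \<in> U \<Longrightarrow> transpose (\<psi> x) = - \<psi> x"
    and inv: "invertible (raise_index (g p) (\<psi> p))"
    and card: "card (eigenvalues (raise_index (g p) (\<psi> p))) = CARD('n)"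
  shows "\<exists>V lam \<theta>. open V \<and> p \<in> V \<and> V \<subseteq> U \<and> adapted_null_coframe V m g \<psi> lam \<theta>"
proof -
  have sym: "transpose (g x) = g x"
    and pos: "v \<noteq> 0 \<Longrightarrow> v \<bullet> (g x *v v) > 0" if "x \<in> U" for x v
    using g that by (auto simp: riemannian_metric_def)
  have sg: "smooth_on U g" using g by (simp add: riemannian_metric_def)
  obtain k0 w0 where "null_eigenframe m (g p) (\<psi> p) k0 w0"
    using ex_null_eigenframe[OF dim sym[OF p] pos[OF p] skew[OF p] inv card] by blast
  then interpret F: null_eigenframe m "g p" "\<psi> p" k0 w0 .
  let ?A = "\<lambda>x. map_matrix complex_of_real (transpose (\<psi> x))"
  let ?B = "\<lambda>x. map_matrix complex_of_real (transpose (g x))"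
  have smooth: "smooth_on U (\<lambda>x. map_matrix complex_of_real (transpose (C x)))" if "smooth_on U C"
    for C :: "real^'n \<Rightarrow> real^'n^'n"
  proof (intro smooth_on_vec[OF U])
    fix i j
    have "smooth_on U (\<lambda>x. complex_of_real (C x $ j $ i))"
      by (intro smooth_on_linear[OF U bounded_linear_of_real] smooth_on_nth[OF U] that)
    then show "smooth_on U (\<lambda>x. map_matrix complex_of_real (transpose (C x)) $ i $ j)"
      by (simp add: transpose_def)
  qed
  have "\<exists>l V v. open V \<and> p \<in> V \<and> V \<subseteq> U \<and> v p = w0 \<mu> \<and> smooth_on V v \<and> form_apply l (w0 \<mu>) = k0 \<mu> \<and>
      (\<forall>x\<in>V. lower (\<psi> x) (v x) = form_apply l (v x) *s lower (g x) (v x))"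
    if \<mu>: "\<mu> \<in> {1..m}" for \<mu>
  proof -
    have k_nz: "k0 \<mu> \<noteq> 0" using F.k_pos[OF \<mu>] by force
    obtain i where i: "w0 \<mu> $ i \<noteq> 0" using F.w_nz[OF \<mu>] by (auto simp: vec_eq_iff)
    \<comment> \<open>This functional returns the eigenvalue on the given eigenvector; a functional that does so exists
      because the eigenvector is not zero, and it determines the scale of the eigenvector because the
      eigenvalue is not zero.\<close>
    define l where "l = (k0 \<mu> / w0 \<mu> $ i) *s axis i 1"
    have l: "form_apply l (w0 \<mu>) = k0 \<mu>"
      using i by (simp add: l_def) (simp add: form_apply_def mult.commute[of "axis i 1 $ _"] sum_mult_axis)
    note k_im = eigenvalue_imaginary[OF F.G_sym F.P_skew F.G_pos F.w_nz[OF \<mu>] F.w_eigen[OF \<mu>], simplified]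
    \<comment> \<open>Pairing the linearised equation with the conjugate eigenvector cancels the two terms that involve
      the eigenvalue and leaves the term with \<open>l w\<close>; then \<open>w\<close> lies in the simple eigenspace.\<close>
    have inj: "w = 0" if "?A p *v w = form_apply l (w0 \<mu>) *s (?B p *v w) + form_apply l w *s (?B p *v w0 \<mu>)" for w
    proof -
      have eq: "lower (\<psi> p) w = k0 \<mu> *s lower (g p) w + form_apply l w *s lower (g p) (w0 \<mu>)"
        using that by (simp add: lower_eq l)
      let ?c = "conj_form (w0 \<mu>)"
      have "cbil (\<psi> p) w ?c = k0 \<mu> * cbil (g p) w ?c + form_apply l w * cbil (g p) (w0 \<mu>) ?c"
        using arg_cong[OF eq, of "\<lambda>\<alpha>. form_apply \<alpha> ?c"] by (simp add: form_apply_lower)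
      moreover have "cbil (\<psi> p) ?c w = - k0 \<mu> * cbil (g p) ?c w"
        using arg_cong[OF eigenvector_conj[OF F.w_eigen[OF \<mu>]], of "\<lambda>\<alpha>. form_apply \<alpha> w"] k_im
        by (simp add: form_apply_lower)
      ultimately have "form_apply l w * cbil (g p) (w0 \<mu>) ?c = 0"
        using cbil_skew[OF F.P_skew, of w ?c] cbil_sym[OF F.G_sym, of w ?c] by algebra
      moreover have "cbil (g p) (w0 \<mu>) ?c \<noteq> 0"
        using cbil_hermitian_pos[OF F.G_sym _ F.w_nz[OF \<mu>]] F.G_pos by force
      ultimately have lw: "form_apply l w = 0" by simp
      then obtain c where "w = c *s w0 \<mu>"
        using F.eigenspace[OF \<mu>, of w] eq by auto
      then show "w = 0" using lw l k_nz by simp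
    qed
    have "?A p *v w0 \<mu> = form_apply l (w0 \<mu>) *s (?B p *v w0 \<mu>)"
      using F.w_eigen[OF \<mu>] by (simp add: l lower_eq)
    from smooth_implicit_eigenvector[OF U p smooth[OF s\<psi>] smooth[OF sg] this inj]
    obtain V v where "open V" "p \<in> V" "V \<subseteq> U" "v p = w0 \<mu>" "smooth_on V v"
      "\<And>x. x \<in> V \<Longrightarrow> ?A x *v v x = form_apply l (v x) *s (?B x *v v x)"
      by metis
    then show ?thesis using l unfolding lower_eq by (intro exI[of _ l] exI[of _ V] exI[of _ v]) blast
  qed
  then obtain l V v where *: "\<forall>\<mu>\<in>{1..m}. open (V \<mu>) \<and> p \<in> V \<mu> \<and> V \<mu> \<subseteq> U \<and> v \<mu> p = w0 \<mu> \<and> smooth_on (V \<mu>) (v \<mu>)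
      \<and> form_apply (l \<mu>) (w0 \<mu>) = k0 \<mu>
      \<and> (\<forall>x\<in>V \<mu>. lower (\<psi> x) (v \<mu> x) = form_apply (l \<mu>) (v \<mu> x) *s lower (g x) (v \<mu> x))"
    by metis
  define \<kappa> where "\<kappa> \<mu> x = form_apply (l \<mu>) (v \<mu> x)" for \<mu> x
  have \<kappa>: "(\<kappa> \<mu> \<longlongrightarrow> k0 \<mu>) (nhds p)" if "\<mu> \<in> {1..m}" for \<mu>
  proof -
    have "v \<mu> differentiable (at p)" using * that by (auto intro: smooth_on_differentiable)
    then have "isCont (\<kappa> \<mu>) p"
      unfolding \<kappa>_def[abs_def]
      by (intro differentiable_imp_continuous_within differentiable_linear[OF bounded_linear_form_apply])
    then have "(\<kappa> \<mu> \<longlongrightarrow> \<kappa> \<mu> p) (nhds p)"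
      by (simp only: isCont_def tendsto_at_iff_tendsto_nhds)
    moreover have "\<kappa> \<mu> p = k0 \<mu>" using * that by (simp add: \<kappa>_def)
    ultimately show ?thesis by simp
  qed
  have "eventually (\<lambda>x. x \<in> V \<mu> \<and> Im (\<kappa> \<mu> x) > 0 \<and> (\<mu> \<noteq> \<nu> \<longrightarrow> \<kappa> \<mu> x \<noteq> \<kappa> \<nu> x)) (nhds p)"
    if "\<mu> \<in> {1..m}" "\<nu> \<in> {1..m}" for \<mu> \<nu>
  proof (intro eventually_conj)
    show "eventually (\<lambda>x. x \<in> V \<mu>) (nhds p)"
      using * that by (intro eventually_nhds_in_open) auto
    show "eventually (\<lambda>x. Im (\<kappa> \<mu> x) > 0) (nhds p)"
      using order_tendstoD(1)[OF tendsto_Im[OF \<kappa>[OF that(1)]] F.k_pos[OF that(1)]] .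
    show "eventually (\<lambda>x. \<mu> \<noteq> \<nu> \<longrightarrow> \<kappa> \<mu> x \<noteq> \<kappa> \<nu> x) (nhds p)"
    proof (cases "\<mu> = \<nu>")
      case False
      then have "k0 \<mu> - k0 \<nu> \<noteq> 0" using F.k_distinct(2)[OF that] by simp
      from tendsto_imp_eventually_ne[OF tendsto_diff[OF \<kappa>[OF that(1)] \<kappa>[OF that(2)]] this]
      show ?thesis by eventually_elim auto
    qed simp
  qed
  then have "eventually (\<lambda>x. \<forall>\<mu>\<in>{1..m}. \<forall>\<nu>\<in>{1..m}. x \<in> V \<mu> \<and> Im (\<kappa> \<mu> x) > 0 \<and> (\<mu> \<noteq> \<nu> \<longrightarrow> \<kappa> \<mu> x \<noteq> \<kappa> \<nu> x)) (nhds p)"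
    by (intro eventually_ball_finite ballI) auto
  then obtain S0 where S0: "open S0" "p \<in> S0" and S0_prop: "\<And>x. x \<in> S0 \<Longrightarrow>
      \<forall>\<mu>\<in>{1..m}. \<forall>\<nu>\<in>{1..m}. x \<in> V \<mu> \<and> Im (\<kappa> \<mu> x) > 0 \<and> (\<mu> \<noteq> \<nu> \<longrightarrow> \<kappa> \<mu> x \<noteq> \<kappa> \<nu> x)"
    unfolding eventually_nhds by blast
  define S where "S = S0 \<inter> U"
  have S: "open S" "p \<in> S" "S \<subseteq> U" using S0 U p by (auto simp: S_def)
  have frame: "null_eigenframe m (g x) (\<psi> x) (\<lambda>\<mu>. \<kappa> \<mu> x) (\<lambda>\<mu>. v \<mu> x)" if "x \<in> S" for x
  proof
    have xS: "x \<in> S0" "x \<in> U" using that by (auto simp: S_def)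
    show "CARD('n) = 2 * m" by (rule dim)
    show "transpose (g x) = g x" "transpose (\<psi> x) = - \<psi> x" using sym skew xS by auto
    show "w \<noteq> 0 \<Longrightarrow> w \<bullet> (g x *v w) > 0" for w by (rule pos[OF xS(2)])
    show im: "Im (\<kappa> \<mu> x) > 0" if "\<mu> \<in> {1..m}" for \<mu> using S0_prop[OF xS(1)] that by blast
    show "v \<mu> x \<noteq> 0" if "\<mu> \<in> {1..m}" for \<mu> using im[OF that] by (auto simp: \<kappa>_def)
    show "lower (\<psi> x) (v \<mu> x) = \<kappa> \<mu> x *s lower (g x) (v \<mu> x)" if "\<mu> \<in> {1..m}" for \<mu>
      using * S0_prop[OF xS(1)] that unfolding \<kappa>_def by blast
    show "inj_on (\<lambda>\<mu>. \<kappa> \<mu> x) {1..m}"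
      using S0_prop[OF xS(1)] unfolding inj_on_def by blast
  qed
  define r where "r \<mu> x = Re (cbil (g x) (v \<mu> x) (conj_form (v \<mu> x)))" for \<mu> x
  define \<theta> where "\<theta> \<mu> x = lower (g x) (complex_of_real (inverse (sqrt (r \<mu> x))) *s v \<mu> x)" for \<mu> x
  have "adapted_null_coframe S m g \<psi> (\<lambda>\<mu> x. - \<kappa> \<mu> x) \<theta>"
    unfolding adapted_null_coframe_def
  proof (intro conjI ballI allI)
    fix \<mu> assume \<mu>: "\<mu> \<in> {1..m}"
    have "S \<subseteq> V \<mu>" using S0_prop \<mu> by (auto simp: S_def)
    then have sv: "smooth_on S (v \<mu>)" using * \<mu> by (auto intro: smooth_on_subset)
    have sgS: "smooth_on S g" using sg S(3) by (rule smooth_on_subset)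
    have "r \<mu> x > 0" if "x \<in> S" for x
    proof -
      interpret null_eigenframe m "g x" "\<psi> x" "\<lambda>\<mu>. \<kappa> \<mu> x" "\<lambda>\<mu>. v \<mu> x" by (rule frame[OF that])
      show ?thesis using cbil_hermitian_pos[OF G_sym _ w_nz[OF \<mu>]] G_pos by (force simp: r_def)
    qed
    then have "smooth_on S (\<lambda>x. inverse (sqrt (r \<mu> x)))"
      unfolding r_def
      by (intro smooth_on_inverse smooth_on_sqrt S smooth_on_linear[OF _ bounded_linear_Re] smooth_on_cbil
          smooth_on_conj_form sv sgS) force+
    then have "smooth_on S (\<lambda>x. \<Sum>i\<in>UNIV. complex_of_real (g x $ i $ j) * (complex_of_real (inverse (sqrt (r \<mu> x))) * v \<mu> x $ i))" for j
      by (intro smooth_on_sum smooth_on_mult smooth_on_linear[OF _ bounded_linear_of_real] smooth_on_nth S sgS sv)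
    then show "smooth_on S (\<theta> \<mu>)"
      unfolding \<theta>_def lower_def by (intro smooth_on_vec S) simp
  next
    fix x assume "x \<in> S"
    then interpret G: null_eigenframe m "g x" "\<psi> x" "\<lambda>\<mu>. \<kappa> \<mu> x" "\<lambda>\<mu>. v \<mu> x" by (rule frame)
    have \<theta>: "\<theta> \<mu> x = G.a \<mu>" for \<mu> by (simp add: \<theta>_def G.a_def G.u_def r_def)
    show "complex_of_real (g x $ i $ j) =
        (\<Sum>\<mu>=1..m. \<theta> \<mu> x $ i * conj_form (\<theta> \<mu> x) $ j + conj_form (\<theta> \<mu> x) $ i * \<theta> \<mu> x $ j)" for i j
      unfolding \<theta> by (rule G.G_eq)
    show "map_matrix complex_of_real (\<psi> x) =
        (\<Sum>\<mu>=1..m. map_matrix ((*) (- \<kappa> \<mu> x)) (wedge (\<theta> \<mu> x) (conj_form (\<theta> \<mu> x))))"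
      unfolding \<theta> by (rule G.P_eq)
  qed
  then show ?thesis using S by blast
qed

section \<open>The complex structures\<close>

lemma integrable_distribution_cong:
  assumes "\<And>x. x \<in> V \<Longrightarrow> D x = D' x"
  shows "integrable_distribution V D \<longleftrightarrow> integrable_distribution V D'"
  unfolding integrable_distribution_def using assms by (simp add: subset_iff) (smt (verit) subset_iff)

context hamiltonian_null_coframe
begin

definition I_struct :: "real^'n \<Rightarrow> real^'n^'n" where
  "I_struct = restrict (\<lambda>x. \<chi> i j. - 2 * (\<Sum>\<mu>=1..m. Im (E \<mu> x $ i * cnj (\<theta> \<mu> x $ j)))) V"

lemma I_struct_at: "x \<in> V \<Longrightarrow> I_struct x = null_coframe_at.I_mat m (g x) (\<lambda>\<mu>. \<theta> \<mu> x)"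
  by (simp add: null_coframe_at.I_mat_def[OF at] E_at I_struct_def)

lemma smooth_I_struct: "smooth_on V I_struct"
proof -
  have "smooth_on V (\<lambda>x. - 2 * (\<Sum>\<mu>=1..m. Im (E \<mu> x $ i * cnj (\<theta> \<mu> x $ j))))" for i j
    by (intro smooth_on_mult smooth_on_const smooth_on_sum smooth_on_linear[OF _ bounded_linear_Im]
        smooth_on_linear[OF _ bounded_linear_cnj] smooth_on_nth smooth_E smooth open_V) auto
  then have "smooth_on V (\<lambda>x. \<chi> i j. - 2 * (\<Sum>\<mu>=1..m. Im (E \<mu> x $ i * cnj (\<theta> \<mu> x $ j))))"
    by (intro smooth_on_vec open_V) simp
  then show ?thesis
    by (subst smooth_on_cong[OF open_V]) (auto simp: I_struct_def)
qed

lemma defines_I_struct: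
  assumes "\<And>x. x \<in> V \<Longrightarrow> D x = null_dist x"
  shows "defines_complex_structure V g D I_struct"
proof -
  have 1: "T10 (I_struct x) = null_dist x" "I_struct x ** I_struct x = - mat 1"
    "transpose (I_struct x) ** g x ** I_struct x = g x" if "x \<in> V" for x
    using null_coframe_at.T10_I[OF at[OF that]] null_coframe_at.I_square[OF at[OF that]]
      null_coframe_at.I_orthogonal[OF at[OF that]]
    by (simp_all add: I_struct_at[OF that] null_dist_at[OF that])
  have "integrable_distribution V (\<lambda>x. T10 (I_struct x))"
    using integrable by (subst integrable_distribution_cong[of V _ null_dist]) (simp_all add: 1)
  then show ?thesis
    using 1 assms smooth_I_struct
    by (simp add: defines_complex_structure_def complex_structure_def orthogonal_structure_iff I_struct_def)
qed

end

lemma defines_complex_structure_unique: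
  assumes "defines_complex_structure V g D I" "defines_complex_structure V g D I'"
  shows "I = I'"
proof (rule extensionalityI)
  show "I \<in> extensional V" "I' \<in> extensional V"
    using assms by (simp_all add: defines_complex_structure_def)
  show "I x = I' x" if "x \<in> V" for x
  proof (rule T10_determines)
    show "I x ** I x = - mat 1"
      using assms(1) that by (simp add: defines_complex_structure_def complex_structure_def)
    show "T10 (I x) \<subseteq> T10 (I' x)"
      using assms that by (simp add: defines_complex_structure_def)
  qed
qed

lemma defines_complex_structure_inj:
  assumes "defines_complex_structure V g D I" "defines_complex_structure V g D' I"
    and "D \<in> extensional V" "D' \<in> extensional V"
  shows "D = D'"
proof (rule extensionalityI[OF assms(3,4)])
  show "D x = D' x" if "x \<in> V" for x
    using assms(1,2) that unfolding defines_complex_structure_def by blast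
qed

text \<open>Interchanging \<open>\<theta> \<mu>\<close> with its conjugate and changing the sign of \<open>lam \<mu>\<close> gives another adapted coframe,
  so it is enough to treat the distribution annihilated by all \<open>\<theta> \<mu>\<close>.\<close>

definition flip_form :: "nat set \<Rightarrow> (nat \<Rightarrow> real^'n::finite \<Rightarrow> complex^'n) \<Rightarrow> nat \<Rightarrow> real^'n \<Rightarrow> complex^'n" where
  "flip_form S \<theta> \<mu> x = (if \<mu> \<in> S then \<theta> \<mu> x else conj_form (\<theta> \<mu> x))"

definition flip_coeff :: "nat set \<Rightarrow> (nat \<Rightarrow> real^'n::finite \<Rightarrow> complex) \<Rightarrow> nat \<Rightarrow> real^'n \<Rightarrow> complex" where
  "flip_coeff S lam \<mu> x = (if \<mu> \<in> S then lam \<mu> x else - lam \<mu> x)"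

lemma adapted_null_coframe_flip:
  assumes "open V" "adapted_null_coframe V m g \<psi> lam \<theta>"
  shows "adapted_null_coframe V m g \<psi> (flip_coeff S lam) (flip_form S \<theta>)"
proof -
  have "smooth_on V (flip_form S \<theta> \<mu>)" if "\<mu> \<in> {1..m}" for \<mu>
    using assms that smooth_on_conj_form[OF assms(1), of "\<theta> \<mu>"]
    by (cases "\<mu> \<in> S") (auto simp: adapted_null_coframe_def flip_form_def[abs_def] eta_contract_eq)
  moreover have "flip_form S \<theta> \<mu> x $ i * conj_form (flip_form S \<theta> \<mu> x) $ j + conj_form (flip_form S \<theta> \<mu> x) $ i * flip_form S \<theta> \<mu> x $ j
      = \<theta> \<mu> x $ i * conj_form (\<theta> \<mu> x) $ j + conj_form (\<theta> \<mu> x) $ i * \<theta> \<mu> x $ j" for \<mu> x i j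
    by (simp add: flip_form_def)
  moreover have "map_matrix ((*) (flip_coeff S lam \<mu> x)) (wedge (flip_form S \<theta> \<mu> x) (conj_form (flip_form S \<theta> \<mu> x)))
      = map_matrix ((*) (lam \<mu> x)) (wedge (\<theta> \<mu> x) (conj_form (\<theta> \<mu> x)))" for \<mu> x
    by (simp add: flip_form_def flip_coeff_def wedge_def vec_eq_iff algebra_simps)
  ultimately show ?thesis
    using assms(2) unfolding adapted_null_coframe_def by simp
qed

lemma annihilator_flip: "annihilator m (\<lambda>\<mu>. \<theta> \<mu> x) S = {v. \<forall>\<mu>\<in>{1..m}. form_apply (flip_form S \<theta> \<mu> x) v = 0}"
  by (simp add: annihilator_def flip_form_def if_distrib)

context hamiltonian_null_coframe
begin

lemma flip: "hamiltonian_null_coframe U V m g J \<omega> \<psi> (flip_coeff S lam) (flip_form S \<theta>)"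
  using dim kaehler hamiltonian distinct open_V VU adapted_null_coframe_flip[OF open_V coframe]
  by unfold_locales

abbreviation "Dist S \<equiv> restrict (\<lambda>x. annihilator m (\<lambda>\<mu>. \<theta> \<mu> x) S) V"

lemma Dist_flip: "x \<in> V \<Longrightarrow> Dist S x = hamiltonian_null_coframe.null_dist m (flip_form S \<theta>) x"
  by (simp add: hamiltonian_null_coframe.null_dist_def[OF flip] annihilator_flip)

lemma isotropic_distributions_eq: "isotropic_distributions V m g \<theta> = Dist ` Pow {1..m}"
proof (intro equalityI subsetI)
  fix D assume "D \<in> isotropic_distributions V m g \<theta>"
  then obtain S where "D \<in> extensional V" "S \<subseteq> {1..m}" "\<forall>x\<in>V. D x = annihilator m (\<lambda>\<mu>. \<theta> \<mu> x) S"
    by (auto simp: isotropic_distributions_def)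
  then have "D = Dist S" by (intro extensionalityI[of D V]) auto
  then show "D \<in> Dist ` Pow {1..m}" using \<open>S \<subseteq> {1..m}\<close> by blast
next
  fix D assume "D \<in> Dist ` Pow {1..m}"
  then obtain S where S: "S \<subseteq> {1..m}" "D = Dist S" by blast
  interpret flip: hamiltonian_null_coframe U V m g J \<omega> \<psi> "flip_coeff S lam" "flip_form S \<theta>" by (rule flip)
  have "vec.subspace (D x) \<and> vec.dim (D x) = m \<and> isotropic (g x) (D x)" if x: "x \<in> V" for x
  proof -
    interpret F: null_coframe_at m "g x" "\<psi> x" "\<lambda>\<mu>. flip_coeff S lam \<mu> x" "\<lambda>\<mu>. flip_form S \<theta> \<mu> x"
      by (rule flip.at[OF x])
    have "D x = F.D" unfolding S(2) Dist_flip[OF x] flip.null_dist_at[OF x] ..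
    then show ?thesis
      using F.D_subspace F.D_dim F.D_isotropic by (simp add: isotropic_def cbil_def)
  qed
  then show "D \<in> isotropic_distributions V m g \<theta>"
    using S by (auto simp: isotropic_distributions_def)
qed

text \<open>Of all the forms of the coframe only the conjugate of \<open>\<theta> \<mu>\<close> does not annihilate \<open>e \<mu>\<close>, so membership of
  \<open>e \<mu>\<close> decides whether \<open>\<theta> \<mu>\<close> was chosen.\<close>

lemma Dist_inj:
  assumes "V \<noteq> {}"
  shows "inj_on Dist (Pow {1..m})"
proof (rule inj_onI)
  fix S S' assume sub: "S \<in> Pow {1..m}" "S' \<in> Pow {1..m}" and eq: "Dist S = Dist S'"
  obtain x where x: "x \<in> V" using assms by blast
  interpret null_coframe_at m "g x" "\<psi> x" "\<lambda>\<mu>. lam \<mu> x" "\<lambda>\<mu>. \<theta> \<mu> x" by (rule at[OF x])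
  have "e \<mu> \<in> annihilator m (\<lambda>\<mu>. \<theta> \<mu> x) T \<longleftrightarrow> \<mu> \<in> T" if "\<mu> \<in> {1..m}" for \<mu> T
    using that dual(2)[OF _ that] dual(4)[OF _ that] by (auto simp: annihilator_def)
  moreover have "annihilator m (\<lambda>\<mu>. \<theta> \<mu> x) S = annihilator m (\<lambda>\<mu>. \<theta> \<mu> x) S'"
    using fun_cong[OF eq, of x] x by simp
  ultimately have "\<mu> \<in> S \<longleftrightarrow> \<mu> \<in> S'" if "\<mu> \<in> {1..m}" for \<mu> using that by blast
  then show "S = S'" using sub by blast
qed

lemma card_isotropic_distributions: "V \<noteq> {} \<Longrightarrow> card (isotropic_distributions V m g \<theta>) = 2 ^ m"
  unfolding isotropic_distributions_eq by (subst card_image[OF Dist_inj]) (simp_all add: card_Pow)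

lemma isotropic_distribution_integrable:
  assumes "D \<in> isotropic_distributions V m g \<theta>"
  shows "integrable_distribution V D" "\<exists>!I. defines_complex_structure V g D I"
proof -
  obtain S where D: "D = Dist S" using assms unfolding isotropic_distributions_eq by blast
  interpret flip: hamiltonian_null_coframe U V m g J \<omega> \<psi> "flip_coeff S lam" "flip_form S \<theta>" by (rule flip)
  have eq: "D x = flip.null_dist x" if "x \<in> V" for x using Dist_flip[OF that] D by simp
  show "integrable_distribution V D"
    by (subst integrable_distribution_cong[of V D flip.null_dist]) (simp_all add: eq flip.integrable)
  show "\<exists>!I. defines_complex_structure V g D I"
    using flip.defines_I_struct[OF eq] defines_complex_structure_unique by blast
qed

lemma card_complex_structures:
  assumes "V \<noteq> {}"
  shows "card {I. \<exists>D\<in>isotropic_distributions V m g \<theta>. defines_complex_structure V g D I} = 2 ^ m"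
proof -
  let ?\<D> = "isotropic_distributions V m g \<theta>" and ?I = "\<lambda>D. THE I. defines_complex_structure V g D I"
  have I: "defines_complex_structure V g D (?I D)" if "D \<in> ?\<D>" for D
    using theI'[OF isotropic_distribution_integrable(2)[OF that]] .
  have "{I. \<exists>D\<in>?\<D>. defines_complex_structure V g D I} = ?I ` ?\<D>"
    using I defines_complex_structure_unique by blast
  moreover have "inj_on ?I ?\<D>"
  proof (rule inj_onI)
    fix D D' assume D: "D \<in> ?\<D>" "D' \<in> ?\<D>" "?I D = ?I D'"
    then have "D \<in> extensional V" "D' \<in> extensional V" by (simp_all add: isotropic_distributions_def)
    then show "D = D'" using I[OF D(1)] I[OF D(2)] D(3) defines_complex_structure_inj by metis
  qed
  ultimately show ?thesis using card_isotropic_distributions[OF assms] by (simp add: card_image)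
qed

end

theorem theorem3p8:
  fixes U :: "(real^'n::finite) set" and m :: nat
    and g J \<omega> \<psi> :: "real^'n \<Rightarrow> real^'n^'n"
  assumes "CARD('n) = 2 * m"
    and "open U"
    and "kaehler U g J \<omega>"
    and "hamiltonian_2form U g J \<omega> \<psi>"
    and "nondegenerate_2form U g \<psi>"
    and "has_distinct_eigenvalues U g \<psi>"
  shows "(\<forall>p\<in>U. \<exists>V lam \<theta>. open V \<and> p \<in> V \<and> V \<subseteq> U \<and> adapted_null_coframe V m g \<psi> lam \<theta>) \<and>
    (\<forall>V lam \<theta>. open V \<and> V \<noteq> {} \<and> V \<subseteq> U \<and> adapted_null_coframe V m g \<psi> lam \<theta> \<longrightarrow>
       card (isotropic_distributions V m g \<theta>) = 2 ^ m \<and>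
       (\<forall>D\<in>isotropic_distributions V m g \<theta>.
          integrable_distribution V D \<and> (\<exists>!I. defines_complex_structure V g D I)) \<and>
       card {I. \<exists>D\<in>isotropic_distributions V m g \<theta>. defines_complex_structure V g D I} = 2 ^ m)"
proof (intro conjI ballI allI impI)
  fix p assume "p \<in> U"
  then show "\<exists>V lam \<theta>. open V \<and> p \<in> V \<and> V \<subseteq> U \<and> adapted_null_coframe V m g \<psi> lam \<theta>"
    using assms by (intro ex_adapted_null_coframe)
      (auto simp: kaehler_def hamiltonian_2form_def nondegenerate_2form_def has_distinct_eigenvalues_def)
next
  fix V lam \<theta> assume "open V \<and> V \<noteq> {} \<and> V \<subseteq> U \<and> adapted_null_coframe V m g \<psi> lam \<theta>"
  then have "V \<noteq> {}" and hnc: "hamiltonian_null_coframe U V m g J \<omega> \<psi> lam \<theta>"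
    using assms by (auto intro!: hamiltonian_null_coframe.intro)
  note * = hamiltonian_null_coframe.card_isotropic_distributions[OF hnc \<open>V \<noteq> {}\<close>]
    hamiltonian_null_coframe.isotropic_distribution_integrable[OF hnc]
    hamiltonian_null_coframe.card_complex_structures[OF hnc \<open>V \<noteq> {}\<close>]
  show "card (isotropic_distributions V m g \<theta>) = 2 ^ m"
    and "card {I. \<exists>D\<in>isotropic_distributions V m g \<theta>. defines_complex_structure V g D I} = 2 ^ m"
    by (rule *)+
  show "integrable_distribution V D" "\<exists>!I. defines_complex_structure V g D I"
    if "D \<in> isotropic_distributions V m g \<theta>" for D
    using *(2,3)[OF that] by auto
qed

end
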